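(* Let $|q|<1$ and let $C=(c_1,\dots,c_m)$, $D=(d_1,\dots,d_m)\in\mathbb{C}^m$. Then, with parameters $\alpha,\beta,x,y,\lambda_2,\lambda_3,t$, $$\sum_{n=0}^\infty \Phi_n(\alpha;x,y)\,\Phi_n(\beta,C;\lambda_2,\lambda_3,D)\frac{t^n}{(q;q)_n} =\frac{(\alpha\lambda_3t,\beta yt,Cxt;q)_\infty}{(x\lambda_3t,y\lambda_2t,y\lambda_3t,Dxt;q)_\infty}\sum_{n=0}^\infty\frac{(\alpha/y,x\lambda_3t;q)_n}{(q,\alpha\lambda_3t;q)_n}\left(\frac{y}{x}\right)^n$$ $$\times\;{}_{m+1}\phi_m\left[\begin{matrix}q^{-n},Dxt\\ Cxt\end{matrix};q,q\right]\;{}_3\phi_2\left[\begin{matrix}\alpha/x,\beta/\lambda_2,y\lambda_3t\\ \alpha\lambda_3tq^n,\beta yt\end{matrix};q,x\lambda_2tq^n\right].$$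
   Context: $(a;q)_\infty=\prod_{k\ge0}(1-aq^k)$, $(a;q)_n=(a;q)_\infty/(aq^n;q)_\infty$ (i.e. $\prod_{k=0}^{n-1}(1-aq^k)$ for $n\ge 0$), and $(a_1,\dots,a_r;q)_n=\prod_{i}(a_i;q)_n$ for $n\in\mathbb{Z}_{\ge0}\cup\{\infty\}$. For a tuple $C=(c_1,\dots,c_m)$ and a number $z$, $Cz$ stands for the list $c_1z,\dots,c_mz$. The basic hypergeometric series is ${}_r\phi_s\left[\begin{matrix}a_1,\dots,a_r\\ b_1,\dots,b_s\end{matrix};q,z\right]=\sum_{n\ge0}\frac{(a_1,\dots,a_r;q)_n}{(q,b_1,\dots,b_s;q)_n}\left((-1)^nq^{n(n-1)/2}\right)^{s+1-r}z^n$; thus ${}_{m+1}\phi_m\left[\begin{matrix}q^{-n},Dxt\\ Cxt\end{matrix};q,q\right]=\sum_{k=0}^n\frac{(q^{-n};q)_k\prod_i(d_ixt;q)_k}{(q;q)_k\prod_i(c_ixt;q)_k}q^k$. Multivariate Al-Salam-Carlitz polynomials: for tuples $A=(a_1,\dots,a_r)$, $B=(b_1,\dots,b_r)$ of complex numbers, $\Phi_n(A;B)$ is defined by $\sum_{n\ge0}\Phi_n(A;B)\frac{z^n}{(q;q)_n}=\frac{\prod_{i}(a_iz;q)_\infty}{\prod_{i}(b_iz;q)_\infty}$; tuples of different lengths are understood as padded with zeros. Here $\Phi_n(\beta,C;\lambda_2,\lambda_3,D)$ has $A=(\beta,c_1,\dots,c_m)$ and $B=(\lambda_2,\lambda_3,d_1,\dots,d_m)$.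 *)

theory Defs
  imports "HOL-Complex_Analysis.Complex_Analysis"
begin

definition qpoch :: "complex \<Rightarrow> complex \<Rightarrow> nat \<Rightarrow> complex" where
  "qpoch a q n = (\<Prod>k<n. 1 - a * q ^ k)"

definition qpoch_inf :: "complex \<Rightarrow> complex \<Rightarrow> complex" where
  "qpoch_inf a q = (\<Prod>k. 1 - a * q ^ k)"

definition qpochs :: "complex list \<Rightarrow> complex \<Rightarrow> nat \<Rightarrow> complex" where
  "qpochs as q n = (\<Prod>a\<leftarrow>as. qpoch a q n)"

definition qpoch_infs :: "complex list \<Rightarrow> complex \<Rightarrow> complex" where
  "qpoch_infs as q = (\<Prod>a\<leftarrow>as. qpoch_inf a q)"

(* The exponent s + 1 - r may be negative, hence the integer power. *)
definition basic_hyp :: "complex list \<Rightarrow> complex list \<Rightarrow> complex \<Rightarrow> complex \<Rightarrow> complex" where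
  "basic_hyp as bs q z =
     (\<Sum>n. qpochs as q n / qpochs (q # bs) q n
          * ((-1) ^ n * q ^ (n * (n - 1) div 2)) powi (int (length bs) + 1 - int (length as))
          * z ^ n)"

(* The polynomials are read off from their generating function in z.  The lists A and B may have
   different lengths: since (0; q)_inf = 1, padding with zeros does not change the products. *)
definition al_salam_carlitz ::
    "complex \<Rightarrow> complex list \<Rightarrow> complex list \<Rightarrow> nat \<Rightarrow> complex" where
  "al_salam_carlitz q A B =
     (THE \<phi>. (\<lambda>z. qpoch_infs (map (\<lambda>a. a * z) A) q / qpoch_infs (map (\<lambda>b. b * z) B) q)
              has_fps_expansion Abs_fps (\<lambda>n. \<phi> n / qpoch q q n))"

lemma qpoch_inf_0 [simp]: "qpoch_inf 0 q = 1"
  by (simp add: qpoch_inf_def)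

lemma qpoch_q_q_nonzero:
  assumes "norm q < 1"
  shows "qpoch q q n \<noteq> 0"
proof -
  have "q * q ^ k \<noteq> 1" for k
  proof
    assume "q * q ^ k = 1"
    hence "norm q ^ Suc k = 1" by (metis norm_one norm_power power_Suc)
    thus False using assms power_less_one_iff[of "norm q" "Suc k"] by simp
  qed
  thus ?thesis by (auto simp: qpoch_def)
qed

lemma qpoch_inf_holomorphic:
  assumes q: "norm q < 1"
  shows "(\<lambda>z. qpoch_inf (a * z) q) holomorphic_on UNIV"
proof -
  have hol: "(\<lambda>z. qpoch_inf (a * z) q) holomorphic_on ball 0 r" if r: "r > 0" for r
  proof -
    define f where "f = (\<lambda>k z. - (a * z * q ^ k))"
    have "uniformly_convergent_on (cball 0 r) (\<lambda>N z. \<Sum>n<N. norm (f n z))"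
    proof (rule Weierstrass_m_test'_ev)
      show "\<forall>\<^sub>F n in sequentially. \<forall>z\<in>cball 0 r. norm (norm (f n z)) \<le> norm a * r * norm q ^ n"
      proof (intro always_eventually allI ballI)
        fix n :: nat and z :: complex assume "z \<in> cball 0 r"
        hence "norm a * norm z * norm q ^ n \<le> norm a * r * norm q ^ n"
          by (intro mult_right_mono mult_left_mono) simp_all
        thus "norm (norm (f n z)) \<le> norm a * r * norm q ^ n"
          by (simp add: f_def norm_mult norm_power)
      qed
      show "summable (\<lambda>n. norm a * r * norm q ^ n)"
        using q by (intro summable_mult summable_geometric) auto
    qed
    hence "uniformly_convergent_on (cball 0 r) (\<lambda>N z. \<Prod>n<N. 1 + f n z)"
      by (intro uniformly_convergent_on_prod) (auto simp: f_def intro!: continuous_intros)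
    then obtain g where g: "uniform_limit (cball 0 r) (\<lambda>N z. \<Prod>n<N. 1 + f n z) g sequentially"
      by (auto simp: uniformly_convergent_on_def)
    have "g holomorphic_on ball 0 r"
      by (rule holomorphic_uniform_limit[OF _ g, THEN conjunct2])
         (auto simp: f_def intro!: always_eventually continuous_intros holomorphic_intros)
    moreover have "g z = qpoch_inf (a * z) q" if z: "z \<in> ball 0 r" for z
    proof -
      have "(\<lambda>N. \<Prod>n<N. 1 + f n z) \<longlonglongrightarrow> g z"
        using tendsto_uniform_limitI[OF g] z by auto
      hence "(\<lambda>N. \<Prod>n\<le>N. 1 + f n z) \<longlonglongrightarrow> g z"
        by (simp only: LIMSEQ_lessThan_iff_atMost)
      moreover have "(\<lambda>N. \<Prod>n\<le>N. 1 + f n z) \<longlonglongrightarrow> (\<Prod>n. 1 + f n z)"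
      proof -
        have "summable (\<lambda>n. norm (a * z) * norm q ^ n)"
          using q by (intro summable_mult summable_geometric) auto
        hence "summable (\<lambda>n. norm (f n z))"
          by (simp add: f_def norm_mult norm_power)
        hence "convergent_prod (\<lambda>n. 1 + f n z)"
          by (simp add: abs_convergent_prod_imp_convergent_prod summable_imp_abs_convergent_prod)
        thus ?thesis
          by (rule convergent_prod_LIMSEQ)
      qed
      ultimately have "g z = (\<Prod>n. 1 + f n z)"
        using LIMSEQ_unique by blast
      thus ?thesis by (simp add: f_def qpoch_inf_def)
    qed
    ultimately show ?thesis by (rule holomorphic_transform)
  qed
  have "(\<lambda>z. qpoch_inf (a * z) q) field_differentiable at z" for z
  proof -
    have "z \<in> ball 0 (norm z + 1)" by simp
    moreover have "(\<lambda>z. qpoch_inf (a * z) q) holomorphic_on ball 0 (norm z + 1)"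
      by (rule hol) (simp add: add_nonneg_pos)
    ultimately show ?thesis
      by (intro holomorphic_on_imp_differentiable_at[OF _ open_ball])
  qed
  thus ?thesis by (simp add: holomorphic_on_def field_differentiable_at_within)
qed

lemma qpoch_infs_holomorphic:
  assumes "norm q < 1"
  shows "(\<lambda>z. qpoch_infs (map (\<lambda>a. a * z) A) q) holomorphic_on UNIV"
  by (induction A)
     (auto simp: qpoch_infs_def intro!: holomorphic_intros qpoch_inf_holomorphic assms)

(* Exactly one sequence has this generating function, so the definite description is proper. *)
lemma al_salam_carlitz_fps_expansion:
  assumes q: "norm q < 1"
  shows "(\<lambda>z. qpoch_infs (map (\<lambda>a. a * z) A) q / qpoch_infs (map (\<lambda>b. b * z) B) q)
           has_fps_expansion Abs_fps (\<lambda>n. al_salam_carlitz q A B n / qpoch q q n)"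
    (is "?F has_fps_expansion _")
proof -
  have "(\<lambda>z. qpoch_infs (map (\<lambda>a. a * z) A) q) analytic_on {0}" for A
    using qpoch_infs_holomorphic[OF q] by (metis analytic_on_open analytic_on_subset open_UNIV subset_UNIV)
  moreover have "qpoch_infs (map (\<lambda>b. b * 0) B) q \<noteq> 0"
    by (induction B) (auto simp: qpoch_infs_def)
  ultimately have "?F analytic_on {0}"
    by (intro analytic_on_divide) auto
  then obtain F where F: "?F has_fps_expansion F"
    using analytic_at_imp_has_fps_expansion_0 by blast
  have nz: "qpoch q q n \<noteq> 0" for n by (rule qpoch_q_q_nonzero[OF q])
  define P where "P = (\<lambda>\<phi>. ?F has_fps_expansion Abs_fps (\<lambda>n. \<phi> n / qpoch q q n))"
  have "P (\<lambda>n. fps_nth F n * qpoch q q n)"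
    using F nz by (simp add: P_def fps_nth_inverse)
  moreover have "\<phi> = (\<lambda>n. fps_nth F n * qpoch q q n)" if "P \<phi>" for \<phi>
  proof -
    have "F = Abs_fps (\<lambda>n. \<phi> n / qpoch q q n)"
      using F that fps_expansion_unique_complex unfolding P_def by blast
    thus ?thesis
      using nz by (auto simp: fun_eq_iff)
  qed
  ultimately have "P (THE \<phi>. P \<phi>)"
    by (rule theI)
  thus ?thesis
    by (simp add: P_def al_salam_carlitz_def)
qed

end

theory Submission
  imports Defs
begin

text \<open>
  Let \<open>F(z) = \<Sum> \<phi>\<^sub>n z\<^sup>n / (q;q)\<^sub>n\<close> be the generating function of the second family and let
  \<open>\<delta>\<close> be the \<open>q\<close>-derivative \<open>(\<delta> F)(z) = (F(z) - F(q z)) / z\<close>. Expanding \<open>\<Phi>\<^sub>n(\<alpha>; x, y)\<close> by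
  the \<open>q\<close>-binomial theorem turns the left-hand side into
  \<open>\<Sum>\<^sub>k (\<alpha>/y;q)\<^sub>k (y t)\<^sup>k / (q;q)\<^sub>k (\<delta>\<^sup>k F)(x t)\<close>.
  Write \<open>F = H G\<close>, where \<open>H\<close> carries the parameters \<open>C, D\<close> and \<open>G\<close> carries
  \<open>\<beta>, \<lambda>\<^sub>2, \<lambda>\<^sub>3\<close>. The \<open>q\<close>-Leibniz rule splits the sum into an outer sum over
  \<open>(\<delta>\<^sup>n H)(x t)\<close>, which is the terminating series with parameter \<open>q\<^sup>-\<^sup>n\<close>, and an inner sum
  of the same shape for \<open>G\<close> with \<open>\<alpha>, x\<close> replaced by \<open>\<alpha> q\<^sup>n, x q\<^sup>n\<close>. The inner sum is
  symmetric in \<open>x q\<^sup>n\<close> and \<open>y\<close>, so it may be expanded at \<open>y t\<close> instead; a second application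
  of the Leibniz rule and the \<open>q\<close>-binomial theorem then give the nonterminating \<open>\<^sub>3\<phi>\<^sub>2\<close>.
\<close>

subsection \<open>q-shifted factorials\<close>

lemma qpoch_0 [simp]: "qpoch a q 0 = 1"
  by (simp add: qpoch_def)

lemma qpoch_Suc: "qpoch a q (Suc n) = qpoch a q n * (1 - a * q ^ n)"
  by (simp add: qpoch_def)

lemma qpoch_add: "qpoch a q (m + n) = qpoch a q m * qpoch (a * q ^ m) q n"
  by (induction n) (simp_all add: qpoch_Suc power_add mult_ac)

lemma qpoch_eq_0_iff: "qpoch a q n = 0 \<longleftrightarrow> (\<exists>k<n. a * q ^ k = 1)"
  by (auto simp: qpoch_def)

lemma convergent_prod_qpoch:
  fixes q :: complex
  assumes "norm q < 1"
  shows "convergent_prod (\<lambda>k. 1 - a * q ^ k)"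
proof -
  have "summable (\<lambda>k. norm (- (a * q ^ k)))"
    using assms by (auto simp: norm_mult norm_power intro!: summable_mult summable_geometric)
  then have "summable (\<lambda>k. norm ((1 - a * q ^ k) - 1))"
    by simp
  then show ?thesis
    by (intro abs_convergent_prod_imp_convergent_prod summable_imp_abs_convergent_prod)
qed

lemma qpoch_tendsto:
  assumes "norm q < 1"
  shows "qpoch a q \<longlonglongrightarrow> qpoch_inf a q"
  using convergent_prod_LIMSEQ[OF convergent_prod_qpoch[OF assms]]
  unfolding qpoch_def qpoch_inf_def by (subst LIMSEQ_lessThan_iff_atMost)

lemma qpoch_inf_split:
  assumes "norm q < 1"
  shows "qpoch_inf a q = qpoch a q n * qpoch_inf (a * q ^ n) q"
proof (rule LIMSEQ_unique)
  show "(\<lambda>m. qpoch a q (n + m)) \<longlonglongrightarrow> qpoch_inf a q"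
    using LIMSEQ_ignore_initial_segment[OF qpoch_tendsto[OF assms], of a n] by (simp add: add.commute)
  show "(\<lambda>m. qpoch a q (n + m)) \<longlonglongrightarrow> qpoch a q n * qpoch_inf (a * q ^ n) q"
    unfolding qpoch_add by (intro tendsto_mult_left qpoch_tendsto assms)
qed

lemma qpoch_inf_nonzero:
  assumes "norm q < 1" "\<And>k. a * q ^ k \<noteq> 1"
  shows "qpoch_inf a q \<noteq> 0"
  unfolding qpoch_inf_def using assms
  by (intro prodinf_nonzero convergent_prod_qpoch) auto

lemma norm_mult_power_less_1:
  fixes a q :: complex
  assumes "norm q < 1" "norm a < 1"
  shows "norm (a * q ^ k) < 1"
proof -
  have "norm a * norm q ^ k \<le> norm a"
    using assms by (intro mult_left_le) (auto simp: power_le_one)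
  then show ?thesis using assms by (simp add: norm_mult norm_power)
qed

lemma mult_power_neq_1:
  fixes a q :: complex
  assumes "norm q < 1" "norm a < 1"
  shows "a * q ^ k \<noteq> 1"
  using norm_mult_power_less_1[OF assms, of k] by auto

lemma qpoch_inf_nonzero':
  assumes "norm q < 1" "norm a < 1"
  shows "qpoch_inf a q \<noteq> 0"
  using assms by (intro qpoch_inf_nonzero mult_power_neq_1)

section \<open>Uniform bounds and rearrangement of double series\<close>

lemma inverse_qpoch_bounded:
  assumes q: "norm q < 1"
  shows "\<exists>N>0. \<forall>n. norm (inverse (qpoch q q n)) \<le> N"
proof -
  have "(\<lambda>n. inverse (qpoch q q n)) \<longlonglongrightarrow> inverse (qpoch_inf q q)"
    by (intro tendsto_inverse qpoch_tendsto qpoch_inf_nonzero' q)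
  then have "Bseq (\<lambda>n. inverse (qpoch q q n))"
    by (intro convergent_imp_Bseq convergentI)
  then show ?thesis
    by (simp add: Bseq_def)
qed

text \<open>The bound is uniform in both indices, so repeated q-differentiation costs only a fixed
  constant in the coefficient estimates below.\<close>

lemma q_binomial_bounded:
  assumes q: "norm q < 1"
  shows "\<exists>K\<ge>0. \<forall>n k. norm (qpoch q q (n + k) / (qpoch q q n * qpoch q q k)) \<le> K"
proof -
  have "Bseq (qpoch q q)"
    by (intro convergent_imp_Bseq convergentI) (rule qpoch_tendsto[OF q])
  then obtain M where M: "M > 0" "\<And>n. norm (qpoch q q n) \<le> M"
    unfolding Bseq_def by blast
  obtain N where N: "N > 0" "\<And>n. norm (inverse (qpoch q q n)) \<le> N"
    using inverse_qpoch_bounded[OF q] by blast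
  have "norm (qpoch q q (n + k) / (qpoch q q n * qpoch q q k)) \<le> M * (N * N)" for n k
    unfolding divide_inverse inverse_mult_distrib norm_mult
    by (intro mult_mono M N) (use M N in auto)
  then show ?thesis
    using M N by (intro exI[of _ "M * (N * N)"]) auto
qed

text \<open>This is \<open>b\<^sup>n (a/b;q)\<^sub>n\<close>, in a form that also makes sense for \<open>b = 0\<close>.\<close>

definition hqpoch :: "complex \<Rightarrow> complex \<Rightarrow> complex \<Rightarrow> nat \<Rightarrow> complex" where
  "hqpoch q a b n = (\<Prod>k<n. b - a * q ^ k)"

lemma hqpoch_0 [simp]: "hqpoch q a b 0 = 1"
  by (simp add: hqpoch_def)

lemma hqpoch_Suc: "hqpoch q a b (Suc n) = hqpoch q a b n * (b - a * q ^ n)"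
  by (simp add: hqpoch_def)

lemma hqpoch_add: "hqpoch q a b (m + n) = hqpoch q a b m * hqpoch q (a * q ^ m) b n"
  by (induction n) (simp_all add: hqpoch_Suc power_add mult_ac)

lemma hqpoch_0_left [simp]: "hqpoch q 0 b n = b ^ n"
  by (simp add: hqpoch_def)

lemma hqpoch_conv_qpoch: "b \<noteq> 0 \<Longrightarrow> hqpoch q a b n = b ^ n * qpoch (a / b) q n"
  by (induction n) (simp_all add: hqpoch_Suc qpoch_Suc field_simps)

text \<open>Taking \<open>u\<close> out of every factor leaves at most 1 + (|a|/u) |q|^k in norm,
  and the product of these converges. Using some positive \<open>u\<close> above |b| instead of |b|
  itself covers b = 0.\<close>

lemma hqpoch_bounded:
  assumes q: "norm q < 1" and u: "norm b \<le> u" "u > 0"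
  shows "\<exists>M\<ge>0. \<forall>n. norm (hqpoch q a b n) \<le> M * u ^ n"
proof -
  \<comment> \<open>The majorant is itself a q-shifted factorial, with base |q| and argument -|a|/u;
    convergence of its partial products supplies \<open>M\<close>.\<close>
  have "Bseq (qpoch (- of_real (norm a / u)) (of_real (norm q)))"
    by (rule convergent_imp_Bseq, rule convergentI, rule qpoch_tendsto) (use q in simp)
  then obtain M where M: "M > 0" "\<And>n. norm (qpoch (- of_real (norm a / u)) (of_real (norm q)) n) \<le> M"
    unfolding Bseq_def by blast
  have "norm (hqpoch q a b n) \<le> M * u ^ n" for n
  proof -
    have "norm (hqpoch q a b n) \<le> (\<Prod>k<n. u * (1 + norm a / u * norm q ^ k))"
      unfolding hqpoch_def prod_norm[symmetric]
    proof (intro prod_mono conjI)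
      fix k
      have "norm (b - a * q ^ k) \<le> norm b + norm a * norm q ^ k"
        by (metis norm_mult norm_power norm_triangle_ineq4)
      then show "norm (b - a * q ^ k) \<le> u * (1 + norm a / u * norm q ^ k)"
        using u by (simp add: distrib_left)
    qed auto
    also have "\<dots> = u ^ n * norm (\<Prod>k<n. complex_of_real (1 + norm a / u * norm q ^ k))"
      using u by (simp add: prod.distrib prod_norm[symmetric] del: of_real_add of_real_mult)
    also have "(\<Prod>k<n. complex_of_real (1 + norm a / u * norm q ^ k))
        = qpoch (- of_real (norm a / u)) (of_real (norm q)) n"
      by (simp add: qpoch_def)
    also have "u ^ n * norm \<dots> \<le> u ^ n * M"
      using u by (intro mult_left_mono M) auto
    finally show ?thesis by (simp add: mult_ac)
  qed
  then show ?thesis using M by (intro exI[of _ M]) auto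
qed

text \<open>Geometric domination makes the family absolutely summable over all pairs, so summing by
  antidiagonals and by rows gives the same total. Every interchange of summation below rests on
  this.\<close>

lemma sums_triangle:
  fixes f :: "nat \<Rightarrow> nat \<Rightarrow> complex"
  assumes su: "0 \<le> s" "s < 1" "0 \<le> u" "u < 1"
    and bound: "\<And>k i. norm (f k i) \<le> K * s ^ k * u ^ i"
  obtains A where "(\<lambda>n. \<Sum>k\<le>n. f k (n - k)) sums A" "(\<lambda>k. \<Sum>i. f k i) sums A" "\<And>k. summable (f k)"
proof -
  let ?g = "\<lambda>(k, i). f k i"
  have K: "K \<ge> 0"
    using order_trans[OF norm_ge_zero bound[of 0 0]] by simp
  have geo: "((\<lambda>n. r ^ n) has_sum (1 / (1 - r))) UNIV" if "0 \<le> r" "r < 1" for r :: real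
    using that by (intro norm_summable_imp_has_sum geometric_sums)
      (auto simp: norm_power intro: summable_geometric)
  have "(\<lambda>(k, i). K * s ^ k * u ^ i) summable_on UNIV \<times> UNIV"
  proof (rule summable_on_SigmaI)
    show "((\<lambda>i. case (k, i) of (k, i) \<Rightarrow> K * s ^ k * u ^ i) has_sum K * s ^ k * (1 / (1 - u))) UNIV" for k
      using has_sum_cmult_right[OF geo[OF su(3,4)], of "K * s ^ k"] by simp
    have "(\<lambda>k. K * (1 / (1 - u)) * s ^ k) summable_on UNIV"
      using geo[OF su(1,2)] by (intro summable_on_cmult_right) (auto simp: summable_on_def)
    then show "(\<lambda>k. K * s ^ k * (1 / (1 - u))) summable_on UNIV"
      by (simp add: mult_ac)
  qed (use su K in auto)
  then have "(\<lambda>p. norm (?g p)) summable_on UNIV \<times> UNIV"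
    by (rule Infinite_Sum.abs_summable_on_comparison_test') (use bound in auto)
  then have summ: "?g summable_on UNIV \<times> UNIV"
    by (rule abs_summable_summable)
  define A where "A = infsum ?g (UNIV \<times> UNIV)"
  have A: "(?g has_sum A) (UNIV \<times> UNIV)"
    using summ by (simp add: A_def)
  have row: "summable (\<lambda>i. norm (f k i))" for k
    by (rule summable_comparison_test'[where g = "\<lambda>i. K * s ^ k * u ^ i"])
      (use su bound in \<open>auto intro!: summable_mult summable_geometric\<close>)
  have "((\<lambda>k. \<Sum>i. f k i) has_sum A) UNIV"
  proof (rule has_sum_SigmaD[OF A])
    fix k
    show "((\<lambda>i. case (k, i) of (k, i) \<Rightarrow> f k i) has_sum (\<Sum>i. f k i)) UNIV"
      using row[of k] by (auto intro!: norm_summable_imp_has_sum summable_sums dest: summable_norm_cancel)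
  qed
  moreover have "((\<lambda>n. \<Sum>k\<le>n. f k (n - k)) has_sum A) UNIV"
  proof (rule has_sum_SigmaD)
    \<comment> \<open>The map (n, k) to (k, n - k) is a bijection from the triangle k <= n onto all
      pairs.\<close>
    show "((\<lambda>(n, k). f k (n - k)) has_sum A) (SIGMA n:UNIV. {..n})"
      by (rule has_sum_reindex_bij_witness
          [where j = "\<lambda>(n, k). (k, n - k)" and i = "\<lambda>(k, i). (k + i, k)", THEN iffD2, OF _ _ _ _ _ refl A]) auto
    show "((\<lambda>k. case (n, k) of (n, k) \<Rightarrow> f k (n - k)) has_sum (\<Sum>k\<le>n. f k (n - k))) {..n}" for n
      by (auto intro!: has_sum_finite)
  qed
  ultimately show thesis
    by (intro that[of A] has_sum_imp_sums summable_norm_cancel[OF row])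
qed

subsection \<open>The q-derivative of a power series\<close>

definition fps_dilate :: "complex \<Rightarrow> complex fps \<Rightarrow> complex fps" where
  "fps_dilate c F = Abs_fps (\<lambda>n. c ^ n * fps_nth F n)"

text \<open>Coefficient form of (F(z) - F(q z)) / z, without the customary factor 1 / (1 -
  q).\<close>

definition qderiv :: "complex \<Rightarrow> complex fps \<Rightarrow> complex fps" where
  "qderiv q F = Abs_fps (\<lambda>n. (1 - q ^ Suc n) * fps_nth F (Suc n))"

text \<open>The \<open>k\<close>-th \<open>q\<close>-derivative divided by \<open>(q;q)\<^sub>k\<close>, which removes the \<open>q\<close>-binomial
  coefficients from the Leibniz rule.\<close>

definition qderiv_div :: "complex \<Rightarrow> nat \<Rightarrow> complex fps \<Rightarrow> complex fps" where
  "qderiv_div q k F =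
     Abs_fps (\<lambda>n. qpoch q q (n + k) / (qpoch q q n * qpoch q q k) * fps_nth F (n + k))"

lemma fps_dilate_mult: "fps_dilate c (F * G) = fps_dilate c F * fps_dilate c G"
proof (rule fps_ext)
  fix n
  have "c ^ n * (fps_nth F i * fps_nth G (n - i)) = (c ^ i * fps_nth F i) * (c ^ (n - i) * fps_nth G (n - i))"
    if "i \<in> {0..n}" for i
  proof -
    have "c ^ n = c ^ i * c ^ (n - i)"
      using that by (simp flip: power_add)
    then show ?thesis by (simp only: mult_ac)
  qed
  then show "fps_nth (fps_dilate c (F * G)) n = fps_nth (fps_dilate c F * fps_dilate c G) n"
    unfolding fps_dilate_def fps_mult_nth fps_nth_Abs_fps sum_distrib_left by (rule sum.cong[OF refl])
qed

lemma fps_dilate_1 [simp]: "fps_dilate 1 F = F"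
  by (simp add: fps_dilate_def fps_eq_iff)

lemma fps_dilate_dilate: "fps_dilate b (fps_dilate c F) = fps_dilate (b * c) F"
  by (simp add: fps_dilate_def fps_eq_iff power_mult_distrib)

text \<open>Since \<open>fps_X\<close> can be cancelled, identities for \<open>qderiv\<close> may be
  checked after multiplying by it, where only differences of dilates occur.\<close>

lemma X_mult_qderiv: "fps_X * qderiv q F = F - fps_dilate q F"
proof (rule fps_ext)
  fix n show "fps_nth (fps_X * qderiv q F) n = fps_nth (F - fps_dilate q F) n"
    by (cases n) (simp_all add: qderiv_def fps_dilate_def algebra_simps)
qed

text \<open>The difference of F G and its dilate telescopes through F times the dilate of G. Putting
  the dilation on the second factor is what later makes G appear at q^l z.\<close>

lemma qderiv_mult: "qderiv q (F * G) = qderiv q F * fps_dilate q G + F * qderiv q G"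
proof -
  have "fps_X * qderiv q (F * G) = F * G - fps_dilate q F * fps_dilate q G"
    by (simp add: X_mult_qderiv fps_dilate_mult)
  also have "\<dots> = (fps_X * qderiv q F) * fps_dilate q G + F * (fps_X * qderiv q G)"
    by (simp add: X_mult_qderiv algebra_simps)
  also have "\<dots> = fps_X * (qderiv q F * fps_dilate q G + F * qderiv q G)"
    by (simp add: algebra_simps)
  finally show ?thesis by simp
qed

lemma qderiv_sum: "qderiv q (\<Sum>i\<in>I. F i) = (\<Sum>i\<in>I. qderiv q (F i))"
  by (simp add: qderiv_def fps_eq_iff fps_sum_nth sum_distrib_left)

lemma qderiv_dilate: "qderiv q (fps_dilate c F) = fps_const c * fps_dilate c (qderiv q F)"
  by (simp add: qderiv_def fps_dilate_def fps_eq_iff)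

lemma fps_dilate_const_mult: "fps_dilate c (fps_const b * F) = fps_const b * fps_dilate c F"
  by (simp add: fps_dilate_def fps_eq_iff)

lemma qderiv_div_0 [simp]: "norm q < 1 \<Longrightarrow> qderiv_div q 0 F = F"
  using qpoch_q_q_nonzero by (simp add: qderiv_div_def fps_eq_iff)

lemma qderiv_qderiv_div:
  assumes "norm q < 1"
  shows "qderiv q (qderiv_div q k F) = fps_const (1 - q ^ Suc k) * qderiv_div q (Suc k) F"
proof (rule fps_ext)
  fix n
  have nz: "1 - q * q ^ m \<noteq> 0" for m
    using qpoch_q_q_nonzero[OF assms, of "Suc m"] by (simp add: qpoch_Suc)
  show "fps_nth (qderiv q (qderiv_div q k F)) n
      = fps_nth (fps_const (1 - q ^ Suc k) * qderiv_div q (Suc k) F) n"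
    using nz[of n] nz[of k] by (simp add: qderiv_def qderiv_div_def qpoch_Suc[of q q n] qpoch_Suc[of q q k])
qed

text \<open>Induction on \<open>k\<close>. Differentiating the l-th term feeds
  \<open>T (Suc l)\<close> and \<open>T l\<close>; after a shift of index the two weights of
  \<open>T l\<close> add up to (1 - q^l) + (q^l - q^(k+1)), which no longer depends on
  \<open>l\<close> and cancels. This is the q-Pascal rule in normalised form.\<close>

lemma qderiv_div_mult:
  assumes q: "norm q < 1"
  shows "qderiv_div q k (F * G)
       = (\<Sum>l\<le>k. qderiv_div q l F * fps_dilate (q ^ l) (qderiv_div q (k - l) G))"
proof (induction k)
  case 0
  show ?case using q by simp
next
  case (Suc k)
  define T where "T = (\<lambda>l. qderiv_div q l F * fps_dilate (q ^ l) (qderiv_div q (Suc k - l) G))"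
  have nz: "1 - q ^ Suc k \<noteq> 0"
    using qpoch_q_q_nonzero[OF q, of "Suc k"] by (simp add: qpoch_Suc)
  have "fps_const (1 - q ^ Suc k) * qderiv_div q (Suc k) (F * G) = qderiv q (qderiv_div q k (F * G))"
    by (simp add: qderiv_qderiv_div q)
  also have "\<dots> = (\<Sum>l\<le>k. qderiv q (qderiv_div q l F) * fps_dilate q (fps_dilate (q ^ l) (qderiv_div q (k - l) G))
      + qderiv_div q l F * qderiv q (fps_dilate (q ^ l) (qderiv_div q (k - l) G)))"
    by (simp add: Suc.IH qderiv_sum qderiv_mult)
  also have "\<dots> = (\<Sum>l\<le>k. fps_const (1 - q ^ Suc l) * T (Suc l) + fps_const (q ^ l - q ^ Suc k) * T l)"
  proof (intro sum.cong refl arg_cong2[of _ _ _ _ "(+)"])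
    fix l assume l: "l \<in> {..k}"
    then have [simp]: "Suc k - l = Suc (k - l)" "q ^ l * q ^ (k - l) = q ^ k"
      by (auto simp: Suc_diff_le simp flip: power_add)
    show "qderiv q (qderiv_div q l F) * fps_dilate q (fps_dilate (q ^ l) (qderiv_div q (k - l) G))
        = fps_const (1 - q ^ Suc l) * T (Suc l)"
      by (simp add: T_def qderiv_qderiv_div q fps_dilate_dilate mult_ac)
    \<comment> \<open>The factor q^l comes from differentiating a dilated series, the factor 1 -
      q^(k-l+1) from the normalisation of \<open>qderiv_div\<close>.\<close>
    have c: "fps_const (q ^ l - q ^ Suc k) = fps_const (q ^ l) * fps_const (1 - q ^ Suc (k - l))"
      by (simp add: algebra_simps)
    show "qderiv_div q l F * qderiv q (fps_dilate (q ^ l) (qderiv_div q (k - l) G))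
        = fps_const (q ^ l - q ^ Suc k) * T l"
      unfolding c T_def qderiv_dilate qderiv_qderiv_div[OF q] fps_dilate_const_mult \<open>Suc k - l = Suc (k - l)\<close>
      by (simp only: mult_ac)
  qed
  also have "\<dots> = (\<Sum>l\<le>k. fps_const (1 - q ^ Suc l) * T (Suc l)) + (\<Sum>l\<le>k. fps_const (q ^ l - q ^ Suc k) * T l)"
    by (rule sum.distrib)
  \<comment> \<open>The terms added to reach a common range, l = 0 here and l = k + 1 in the next
    step, have weight zero.\<close>
  also have "(\<Sum>l\<le>k. fps_const (1 - q ^ Suc l) * T (Suc l)) = (\<Sum>l\<le>Suc k. fps_const (1 - q ^ l) * T l)"
    unfolding sum.atMost_Suc_shift by simp
  also have "(\<Sum>l\<le>k. fps_const (q ^ l - q ^ Suc k) * T l) = (\<Sum>l\<le>Suc k. fps_const (q ^ l - q ^ Suc k) * T l)"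
    by simp
  also have "(\<Sum>l\<le>Suc k. fps_const (1 - q ^ l) * T l) + (\<Sum>l\<le>Suc k. fps_const (q ^ l - q ^ Suc k) * T l)
      = (\<Sum>l\<le>Suc k. fps_const (1 - q ^ Suc k) * T l)"
    unfolding sum.distrib[symmetric] distrib_right[symmetric] by simp
  also have "\<dots> = fps_const (1 - q ^ Suc k) * (\<Sum>l\<le>Suc k. T l)"
    by (rule sum_distrib_left[symmetric])
  finally show ?case
    using nz unfolding T_def by simp
qed

section \<open>Coefficient bounds, radii of convergence and evaluation\<close>

lemma fps_coeff_bound:
  fixes F :: "complex fps"
  assumes "r > 0" "ereal r < fps_conv_radius F"
  shows "\<exists>M\<ge>0. \<forall>n. norm (fps_nth F n) \<le> M / r ^ n"
proof -
  have "summable (\<lambda>n. fps_nth F n * of_real r ^ n)"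
    using assms by (intro summable_fps) simp
  then have "Bseq (\<lambda>n. fps_nth F n * of_real r ^ n)"
    by (intro convergent_imp_Bseq) (auto simp: convergent_def dest: summable_LIMSEQ_zero)
  then obtain M where "M > 0" "\<And>n. norm (fps_nth F n * of_real r ^ n) \<le> M"
    unfolding Bseq_def by blast
  then show ?thesis
    using assms by (intro exI[of _ M]) (auto simp: norm_mult norm_power field_simps)
qed

text \<open>A coefficient bound at some r' strictly between \<open>r\<close> and \<open>R\<close>
  dominates the series at \<open>r\<close> by a geometric series of ratio r / r'.\<close>

lemma fps_conv_radius_geI:
  fixes F :: "complex fps"
  assumes "\<And>r. r > 0 \<Longrightarrow> ereal r < R \<Longrightarrow> \<exists>M. \<forall>n. norm (fps_nth F n) \<le> M / r ^ n"
  shows "R \<le> fps_conv_radius F"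
  unfolding fps_conv_radius_def
proof (rule conv_radius_geI_ex')
  fix r :: real assume r: "0 < r" "ereal r < R"
  obtain r' where r': "r < r'" "ereal r' < R"
    using ereal_dense2[OF r(2)] by auto
  obtain M where M: "\<And>n. norm (fps_nth F n) \<le> M / r' ^ n"
    using assms[of r'] r r' by auto
  show "summable (\<lambda>n. fps_nth F n * complex_of_real r ^ n)"
  proof (rule summable_comparison_test'[where g = "\<lambda>n. M * (r / r') ^ n"])
    show "summable (\<lambda>n. M * (r / r') ^ n)"
      using r r' by (intro summable_mult summable_geometric) auto
    show "norm (fps_nth F n * complex_of_real r ^ n) \<le> M * (r / r') ^ n" for n
      using mult_right_mono[OF M, of "r ^ n" n] r by (simp add: norm_mult norm_power power_divide)
  qed
qed

lemma fps_conv_radius_dilate: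
  assumes "norm c \<le> 1"
  shows "fps_conv_radius F \<le> fps_conv_radius (fps_dilate c F)"
proof (rule fps_conv_radius_geI)
  fix r :: real assume "r > 0" "ereal r < fps_conv_radius F"
  then obtain M where M: "\<And>n. norm (fps_nth F n) \<le> M / r ^ n"
    using fps_coeff_bound by blast
  have "norm (fps_nth (fps_dilate c F) n) \<le> M / r ^ n" for n
  proof -
    have "norm c ^ n * norm (fps_nth F n) \<le> 1 * norm (fps_nth F n)"
      using assms by (intro mult_right_mono power_le_one) auto
    then show ?thesis
      using M[of n] by (simp add: fps_dilate_def norm_mult norm_power)
  qed
  then show "\<exists>M. \<forall>n. norm (fps_nth (fps_dilate c F) n) \<le> M / r ^ n" by blast
qed

lemma eval_fps_dilate: "eval_fps (fps_dilate c F) z = eval_fps F (c * z)"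
  by (simp add: eval_fps_def fps_dilate_def power_mult_distrib mult_ac)

lemma qderiv_div_coeff_bound:
  assumes q: "norm q < 1" and r: "r > 0" "ereal r < fps_conv_radius F"
  shows "\<exists>M\<ge>0. \<forall>n k. norm (fps_nth (qderiv_div q k F) n) \<le> M / r ^ (n + k)"
proof -
  obtain M where M: "M \<ge> 0" "\<And>n. norm (fps_nth F n) \<le> M / r ^ n"
    using fps_coeff_bound[OF r] by blast
  obtain K where K: "K \<ge> 0" "\<And>n k. norm (qpoch q q (n + k) / (qpoch q q n * qpoch q q k)) \<le> K"
    using q_binomial_bounded[OF q] by blast
  have "norm (fps_nth (qderiv_div q k F) n) \<le> K * (M / r ^ (n + k))" for n k
    unfolding qderiv_div_def fps_nth_Abs_fps norm_mult[of "_ / _"]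
    by (intro mult_mono K M) (use K in auto)
  then show ?thesis
    using K M by (intro exI[of _ "K * M"]) auto
qed

lemma fps_conv_radius_qderiv_div:
  assumes q: "norm q < 1"
  shows "fps_conv_radius F \<le> fps_conv_radius (qderiv_div q k F)"
proof (rule fps_conv_radius_geI)
  fix r :: real assume r: "r > 0" "ereal r < fps_conv_radius F"
  obtain M where "\<And>n k. norm (fps_nth (qderiv_div q k F) n) \<le> M / r ^ (n + k)"
    using qderiv_div_coeff_bound[OF q r] by blast
  then show "\<exists>M. \<forall>n. norm (fps_nth (qderiv_div q k F) n) \<le> M / r ^ n"
    by (intro exI[of _ "M / r ^ k"]) (simp add: power_add mult.commute[of "r ^ k"])
qed

text \<open>The constant is uniform in \<open>k\<close> and in the disc of radius \<open>s\<close>,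
  while the decay has the larger radius \<open>r\<close>. This beats the growth |y t|^k in the
  series of q-derivatives as soon as |y t| < r.\<close>

lemma eval_qderiv_div_bound:
  assumes q: "norm q < 1" and r: "0 \<le> s" "s < r" "ereal r < fps_conv_radius F"
  shows "\<exists>M\<ge>0. \<forall>k z. norm z \<le> s \<longrightarrow> norm (eval_fps (qderiv_div q k F) z) \<le> M / r ^ k"
proof -
  have r0: "r > 0" using r by simp
  obtain M where M: "M \<ge> 0" "\<And>n k. norm (fps_nth (qderiv_div q k F) n) \<le> M / r ^ (n + k)"
    using qderiv_div_coeff_bound[OF q r0 r(3)] by blast
  have "norm (eval_fps (qderiv_div q k F) z) \<le> M / (1 - s / r) / r ^ k" if z: "norm z \<le> s" for k z
  proof -
    have le: "norm (fps_nth (qderiv_div q k F) n * z ^ n) \<le> M / r ^ k * (s / r) ^ n" for n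
    proof -
      have "norm (fps_nth (qderiv_div q k F) n * z ^ n) \<le> M / r ^ (n + k) * s ^ n"
        unfolding norm_mult norm_power
        by (intro mult_mono M power_mono z) (use M r0 in auto)
      then show ?thesis by (simp add: power_add power_divide mult_ac)
    qed
    have sr: "0 \<le> s / r" "s / r < 1" using r r0 by auto
    then have "(\<lambda>n. M / r ^ k * (s / r) ^ n) sums (M / r ^ k * (1 / (1 - s / r)))"
      by (intro sums_mult geometric_sums) auto
    then have "norm (eval_fps (qderiv_div q k F) z) \<le> M / r ^ k * (1 / (1 - s / r))"
      unfolding eval_fps_def sums_iff using norm_suminf_le[of _ "\<lambda>n. M / r ^ k * (s / r) ^ n", OF le] by metis
    then show ?thesis by (simp add: mult.commute)
  qed
  then show ?thesis
    using M r r0 by (intro exI[of _ "M / (1 - s / r)"]) auto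
qed

lemma eval_fps_sum:
  fixes F :: "'i \<Rightarrow> complex fps"
  assumes "finite I" "\<And>i. i \<in> I \<Longrightarrow> ereal (norm z) < fps_conv_radius (F i)"
  shows "eval_fps (\<Sum>i\<in>I. F i) z = (\<Sum>i\<in>I. eval_fps (F i) z)
         \<and> ereal (norm z) < fps_conv_radius (\<Sum>i\<in>I. F i)"
  using assms
proof (induction I)
  case (insert i I)
  have "min (fps_conv_radius (F i)) (fps_conv_radius (\<Sum>i\<in>I. F i)) \<le> fps_conv_radius (F i + (\<Sum>i\<in>I. F i))"
    by (rule fps_conv_radius_add)
  moreover have "ereal (norm z) < min (fps_conv_radius (F i)) (fps_conv_radius (\<Sum>i\<in>I. F i))"
    using insert by simp
  ultimately have "ereal (norm z) < fps_conv_radius (F i + (\<Sum>i\<in>I. F i))"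
    by (rule order.strict_trans2[rotated])
  then show ?case
    using insert by (simp add: eval_fps_add)
qed auto

lemma eval_qderiv_div_mult:
  assumes q: "norm q < 1"
    and z: "ereal (norm z) < fps_conv_radius F" "ereal (norm z) < fps_conv_radius G"
  shows "eval_fps (qderiv_div q k (F * G)) z
       = (\<Sum>l\<le>k. eval_fps (qderiv_div q l F) z * eval_fps (qderiv_div q (k - l) G) (q ^ l * z))"
proof -
  have F: "ereal (norm z) < fps_conv_radius (qderiv_div q l F)" for l
    using z(1) fps_conv_radius_qderiv_div[OF q] by (rule order.strict_trans2)
  have "fps_conv_radius G \<le> fps_conv_radius (fps_dilate (q ^ l) (qderiv_div q m G))" for l m
    using fps_conv_radius_qderiv_div[OF q] fps_conv_radius_dilate
    by (rule order.trans) (use q in \<open>auto simp: norm_power power_le_one\<close>)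
  then have G: "ereal (norm z) < fps_conv_radius (fps_dilate (q ^ l) (qderiv_div q m G))" for l m
    using z(2) by (meson order.strict_trans2)
  have "eval_fps (qderiv_div q k (F * G)) z
      = (\<Sum>l\<le>k. eval_fps (qderiv_div q l F * fps_dilate (q ^ l) (qderiv_div q (k - l) G)) z)"
    unfolding qderiv_div_mult[OF q]
    by (rule eval_fps_sum[THEN conjunct1])
      (use F G in \<open>auto intro!: order.strict_trans2[OF _ fps_conv_radius_mult]\<close>)
  then show ?thesis
    by (simp add: eval_fps_mult F G eval_fps_dilate)
qed

subsection \<open>The q-binomial theorem\<close>

text \<open>The expansion of (a z; q)_inf / (b z; q)_inf according to the q-binomial theorem; the
  use of \<open>hqpoch\<close> keeps b = 0 available.\<close>

definition asc_fps :: "complex \<Rightarrow> complex \<Rightarrow> complex \<Rightarrow> complex fps" where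
  "asc_fps q a b = Abs_fps (\<lambda>n. hqpoch q a b n / qpoch q q n)"

lemma fps_conv_radius_asc_fps:
  assumes q: "norm q < 1" and R: "norm b * R \<le> 1"
  shows "ereal R \<le> fps_conv_radius (asc_fps q a b)"
proof (rule fps_conv_radius_geI)
  fix r :: real assume r: "r > 0" "ereal r < ereal R"
  have "norm b * r \<le> norm b * R"
    using r by (intro mult_left_mono) auto
  then have "norm b \<le> 1 / r"
    using R r by (simp add: field_simps)
  then obtain M where M: "M \<ge> 0" "\<And>n. norm (hqpoch q a b n) \<le> M * (1 / r) ^ n"
    using hqpoch_bounded[OF q, of b "1 / r" a] r by auto
  obtain N where N: "N > 0" "\<And>n. norm (inverse (qpoch q q n)) \<le> N"
    using inverse_qpoch_bounded[OF q] by blast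
  have "norm (fps_nth (asc_fps q a b) n) \<le> M * (1 / r) ^ n * N" for n
    unfolding asc_fps_def fps_nth_Abs_fps divide_inverse[of "hqpoch _ _ _ _"] norm_mult
    by (intro mult_mono M N) (use M r in auto)
  then show "\<exists>M. \<forall>n. norm (fps_nth (asc_fps q a b) n) \<le> M / r ^ n"
    by (intro exI[of _ "M * N"]) (simp add: power_one_over field_simps)
qed

lemma norm_less_conv_radius_asc_fps:
  assumes q: "norm q < 1" and z: "norm (b * z) < 1"
  shows "ereal (norm z) < fps_conv_radius (asc_fps q a b)"
proof -
  have "\<exists>R > norm z. norm b * R \<le> 1"
  proof (cases "b = 0")
    case False
    with z have "norm z < 1 / norm b"
      by (simp add: norm_mult field_simps)
    then show ?thesis using False by (intro exI[of _ "1 / norm b"]) auto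
  qed (auto intro: exI[of _ "norm z + 1"])
  then obtain R where "norm z < R" "norm b * R \<le> 1" by blast
  then show ?thesis
    using fps_conv_radius_asc_fps[OF q, of b R a] by (meson less_ereal.simps(1) order.strict_trans2)
qed

text \<open>Once the constant terms are split off, this is the recurrence c_(n+1) (1 - q^(n+1)) =
  c_n (b - a q^n) for the coefficients.\<close>

lemma asc_fps_functional_eq:
  assumes q: "norm q < 1" and z: "norm (b * z) < 1"
  shows "(1 - b * z) * eval_fps (asc_fps q a b) z = (1 - a * z) * eval_fps (asc_fps q a b) (q * z)"
proof -
  let ?F = "asc_fps q a b"
  have z': "norm (b * (q * z)) < 1"
    using norm_mult_power_less_1[OF q z, of 1] by (simp add: mult_ac)
  have s: "(\<lambda>n. fps_nth ?F n * z ^ n) sums eval_fps ?F z"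
    and s': "(\<lambda>n. fps_nth ?F n * (q * z) ^ n) sums eval_fps ?F (q * z)"
    by (intro sums_eval_fps norm_less_conv_radius_asc_fps q z z')+
  have c0: "fps_nth ?F 0 = 1" by (simp add: asc_fps_def)
  have shift: "(\<lambda>n. fps_nth ?F (Suc n) * w ^ Suc n) sums (eval_fps ?F w - 1)"
    if "(\<lambda>n. fps_nth ?F n * w ^ n) sums eval_fps ?F w" for w
    using that c0 by (subst sums_Suc_iff) simp
  have "(\<lambda>n. fps_nth ?F (Suc n) * z ^ Suc n - b * z * (fps_nth ?F n * z ^ n))
      sums (eval_fps ?F z - 1 - b * z * eval_fps ?F z)"
    by (intro sums_diff shift s sums_mult)
  moreover have "(\<lambda>n. fps_nth ?F (Suc n) * (q * z) ^ Suc n - a * z * (fps_nth ?F n * (q * z) ^ n))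
      sums (eval_fps ?F (q * z) - 1 - a * z * eval_fps ?F (q * z))"
    by (intro sums_diff shift s' sums_mult)
  moreover have "fps_nth ?F (Suc n) * z ^ Suc n - b * z * (fps_nth ?F n * z ^ n)
      = fps_nth ?F (Suc n) * (q * z) ^ Suc n - a * z * (fps_nth ?F n * (q * z) ^ n)" for n
  proof -
    have "1 - q ^ Suc n \<noteq> 0"
      using qpoch_q_q_nonzero[OF q, of "Suc n"] by (simp add: qpoch_Suc)
    then have "fps_nth ?F (Suc n) * (1 - q ^ Suc n) = fps_nth ?F n * (b - a * q ^ n)"
      by (simp add: asc_fps_def hqpoch_Suc qpoch_Suc)
    then have "fps_nth ?F (Suc n) * (1 - q ^ Suc n) * z ^ Suc n = fps_nth ?F n * (b - a * q ^ n) * z ^ Suc n"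
      by simp
    then show ?thesis
      by (simp add: power_mult_distrib algebra_simps)
  qed
  ultimately have "eval_fps ?F z - 1 - b * z * eval_fps ?F z
      = eval_fps ?F (q * z) - 1 - a * z * eval_fps ?F (q * z)"
    using sums_unique2 by (metis (no_types, lifting) sums_cong)
  then show ?thesis by (simp add: algebra_simps)
qed

text \<open>Iterating the functional equation moves the argument to q^n z, which tends to 0, where
  the series is continuous with value 1; the accumulated factors tend to the infinite
  products.\<close>

lemma eval_asc_fps:
  assumes q: "norm q < 1" and z: "norm (b * z) < 1"
  shows "eval_fps (asc_fps q a b) z = qpoch_inf (a * z) q / qpoch_inf (b * z) q"
proof -
  let ?f = "eval_fps (asc_fps q a b)"
  have zn: "norm (b * (q ^ n * z)) < 1" for n
    using norm_mult_power_less_1[OF q z, of n] by (simp add: mult_ac)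
  have iter: "qpoch (b * z) q n * ?f z = qpoch (a * z) q n * ?f (q ^ n * z)" for n
  proof (induction n)
    case (Suc n)
    have "qpoch (b * z) q (Suc n) * ?f z = (1 - b * (q ^ n * z)) * (qpoch (b * z) q n * ?f z)"
      by (simp add: qpoch_Suc mult_ac)
    also have "\<dots> = qpoch (a * z) q n * ((1 - b * (q ^ n * z)) * ?f (q ^ n * z))"
      by (simp add: Suc.IH mult_ac)
    also have "\<dots> = qpoch (a * z) q (Suc n) * ?f (q ^ Suc n * z)"
      unfolding asc_fps_functional_eq[OF q zn] by (simp add: qpoch_Suc mult_ac)
    finally show ?case .
  qed simp
  have "isCont ?f 0"
    using norm_less_conv_radius_asc_fps[OF q, of b 0 a]
    by (intro continuous_eval_fps) simp
  moreover have "(\<lambda>n. q ^ n * z) \<longlonglongrightarrow> 0"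
    using q by (intro tendsto_mult_left_zero LIMSEQ_power_zero)
  ultimately have "(\<lambda>n. ?f (q ^ n * z)) \<longlonglongrightarrow> ?f 0"
    by (rule isCont_tendsto_compose)
  then have "(\<lambda>n. qpoch (a * z) q n * ?f (q ^ n * z)) \<longlonglongrightarrow> qpoch_inf (a * z) q * 1"
    by (intro tendsto_mult qpoch_tendsto q) (simp add: eval_fps_at_0 asc_fps_def)
  moreover have "(\<lambda>n. qpoch (b * z) q n * ?f z) \<longlonglongrightarrow> qpoch_inf (b * z) q * ?f z"
    by (intro tendsto_mult_right qpoch_tendsto q)
  ultimately have "qpoch_inf (b * z) q * ?f z = qpoch_inf (a * z) q"
    using LIMSEQ_unique unfolding iter by fastforce
  then show ?thesis
    using qpoch_inf_nonzero'[OF q z] by (simp add: field_simps)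
qed

text \<open>The family is closed under q-differentiation up to constants: only the numerator
  parameter moves, from a to a q^k.\<close>

lemma qderiv_div_asc_fps:
  assumes q: "norm q < 1"
  shows "qderiv_div q k (asc_fps q a b) = fps_const (hqpoch q a b k / qpoch q q k) * asc_fps q (a * q ^ k) b"
proof (rule fps_ext)
  fix n
  have "hqpoch q a b (n + k) = hqpoch q a b k * hqpoch q (a * q ^ k) b n"
    using hqpoch_add[of q a b k n] by (simp add: add.commute)
  then show "fps_nth (qderiv_div q k (asc_fps q a b)) n
      = fps_nth (fps_const (hqpoch q a b k / qpoch q q k) * asc_fps q (a * q ^ k) b) n"
    using qpoch_q_q_nonzero[OF q] by (simp add: qderiv_div_def asc_fps_def)
qed

lemma eval_qderiv_div_asc_fps:
  assumes q: "norm q < 1" and z: "norm (b * z) < 1"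
  shows "eval_fps (qderiv_div q k (asc_fps q a b)) z
       = hqpoch q a b k / qpoch q q k * (qpoch_inf (a * q ^ k * z) q / qpoch_inf (b * z) q)"
  unfolding qderiv_div_asc_fps[OF q] using assms
  by (subst eval_fps_mult) (auto simp: eval_asc_fps norm_less_conv_radius_asc_fps)

section \<open>Higher q-derivatives as finite sums of dilated values\<close>

lemma X_mult_qderiv_div_Suc:
  assumes "norm q < 1"
  shows "fps_const (1 - q ^ Suc k) * (fps_X * qderiv_div q (Suc k) F)
       = qderiv_div q k F - fps_dilate q (qderiv_div q k F)"
  unfolding X_mult_qderiv[symmetric] qderiv_qderiv_div[OF assms] by (simp only: mult_ac)

lemma eval_qderiv_div_Suc:
  assumes q: "norm q < 1" and z: "ereal (norm z) < fps_conv_radius F"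
  shows "(1 - q ^ Suc k) * (z * eval_fps (qderiv_div q (Suc k) F) z)
       = eval_fps (qderiv_div q k F) z - eval_fps (qderiv_div q k F) (q * z)"
proof -
  have zk: "ereal (norm z) < fps_conv_radius (qderiv_div q k F)" for k
    using z fps_conv_radius_qderiv_div[OF q] by (rule order.strict_trans2)
  have zd: "ereal (norm z) < fps_conv_radius (fps_dilate q (qderiv_div q k F))"
    by (rule order.strict_trans2[OF zk fps_conv_radius_dilate]) (use q in simp)
  have "ereal (norm z) < fps_conv_radius (fps_X * qderiv_div q (Suc k) F)"
    using zk[of "Suc k"] by (intro order.strict_trans2[OF _ fps_conv_radius_mult]) simp
  then have "eval_fps (fps_const (1 - q ^ Suc k) * (fps_X * qderiv_div q (Suc k) F)) z
      = (1 - q ^ Suc k) * (z * eval_fps (qderiv_div q (Suc k) F) z)"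
    using zk by (simp add: eval_fps_mult del: power_Suc)
  then show ?thesis
    unfolding X_mult_qderiv_div_Suc[OF q] by (simp add: eval_fps_diff zk zd eval_fps_dilate)
qed

text \<open>The weight of F(q^i z) in the k-th q-difference, and at the same time the part of the
  terminating series that does not involve C and D.\<close>

definition qdiff_coeff :: "complex \<Rightarrow> nat \<Rightarrow> nat \<Rightarrow> complex" where
  "qdiff_coeff q k i = qpoch (q powi (- int k)) q i / qpoch q q i * q ^ i"

lemma qpoch_neg_power_eq_0:
  assumes "q \<noteq> 0" "k < i"
  shows "qpoch (q powi (- int k)) q i = 0"
  using assms by (auto simp: qpoch_eq_0_iff power_int_minus intro!: exI[of _ k])

text \<open>All three coefficients are multiples of (q^(-k); q)_i / (q; q)_i, because the leading
  factor of (q^(-k-1); q)_(i+1) splits off; a rational identity remains.\<close>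

lemma qdiff_coeff_Suc:
  assumes q: "q \<noteq> 0" "norm q < 1"
  shows "qdiff_coeff q (Suc k) (Suc i) = qdiff_coeff q k (Suc i) - qdiff_coeff q k i / q ^ k"
proof -
  have nz: "qpoch q q i \<noteq> 0" "1 - q * q ^ i \<noteq> 0"
    using qpoch_q_q_nonzero[OF q(2), of "Suc i"] by (auto simp: qpoch_Suc)
  have "q powi (- int (Suc k)) * q = q powi (- int k)"
    using q unfolding power_int_minus power_int_of_nat by simp
  then have sh: "qpoch (q powi (- int (Suc k))) q (Suc i)
      = (1 - q powi (- int (Suc k))) * qpoch (q powi (- int k)) q i"
    using qpoch_add[of "q powi (- int (Suc k))" q 1 i] qpoch_Suc[of "q powi (- int (Suc k))" q 0]
    by simp
  define P Q where "P = qpoch (q powi (- int k)) q i" and "Q = qpoch q q i"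
  have e1: "qdiff_coeff q (Suc k) (Suc i)
      = (1 - inverse (q * q ^ k)) * P / (Q * (1 - q * q ^ i)) * (q * q ^ i)"
    unfolding qdiff_coeff_def sh P_def Q_def qpoch_Suc[of q q]
    by (simp only: power_int_minus power_int_of_nat power_Suc)
  have e2: "qdiff_coeff q k (Suc i)
      = P * (1 - inverse (q ^ k) * q ^ i) / (Q * (1 - q * q ^ i)) * (q * q ^ i)"
    unfolding qdiff_coeff_def P_def Q_def qpoch_Suc power_int_minus power_int_of_nat by simp
  have e3: "qdiff_coeff q k i = P / Q * q ^ i"
    by (simp add: qdiff_coeff_def P_def Q_def)
  show ?thesis
    using q nz unfolding e1 e2 e3 Q_def[symmetric] by (simp add: field_simps)
qed

text \<open>The point \<open>z\<close> stays arbitrary in the induction since the step uses the k-th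
  q-derivative at both z and q z. At q z the induction hypothesis carries (q z)^k, whence the
  division by q^k.\<close>

lemma eval_qderiv_div_conv_sum:
  assumes q: "q \<noteq> 0" "norm q < 1" and z: "ereal (norm z) < fps_conv_radius F"
  shows "qpoch q q k * z ^ k * eval_fps (qderiv_div q k F) z
       = (\<Sum>i\<le>k. qdiff_coeff q k i * eval_fps F (q ^ i * z))"
  using z
proof (induction k arbitrary: z)
  case 0
  then show ?case using q by (simp add: qdiff_coeff_def)
next
  case (Suc k)
  let ?f = "\<lambda>i. eval_fps F (q ^ i * z)" and ?D = "\<lambda>k z. eval_fps (qderiv_div q k F) z"
  have "norm (q * z) \<le> norm z"
    using q by (simp add: norm_mult mult_left_le_one_le)
  then have qz: "ereal (norm (q * z)) < fps_conv_radius F"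
    using Suc.prems by (meson ereal_less_eq(3) order.strict_trans1)
  have "qpoch q q (Suc k) * z ^ Suc k * ?D (Suc k) z
      = qpoch q q k * z ^ k * ((1 - q ^ Suc k) * (z * ?D (Suc k) z))"
    by (simp add: qpoch_Suc)
  also have "\<dots> = qpoch q q k * z ^ k * ?D k z - qpoch q q k * (q * z) ^ k * ?D k (q * z) / q ^ k"
    unfolding eval_qderiv_div_Suc[OF q(2) Suc.prems] using q by (simp add: power_mult_distrib right_diff_distrib)
  also have "\<dots> = (\<Sum>i\<le>k. qdiff_coeff q k i * ?f i) - (\<Sum>i\<le>k. qdiff_coeff q k i / q ^ k * ?f (Suc i))"
    unfolding Suc.IH[OF Suc.prems] Suc.IH[OF qz] by (simp add: sum_divide_distrib mult_ac)
  \<comment> \<open>The extra term i = k + 1 vanishes, since (q^(-k); q)_i has a zero factor for i >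
    k.\<close>
  also have "(\<Sum>i\<le>k. qdiff_coeff q k i * ?f i) = (\<Sum>i\<le>Suc k. qdiff_coeff q k i * ?f i)"
    using q by (simp add: qdiff_coeff_def qpoch_neg_power_eq_0)
  also have "\<dots> = qdiff_coeff q k 0 * ?f 0 + (\<Sum>i\<le>k. qdiff_coeff q k (Suc i) * ?f (Suc i))"
    by (rule sum.atMost_Suc_shift)
  also have "\<dots> - (\<Sum>i\<le>k. qdiff_coeff q k i / q ^ k * ?f (Suc i))
      = qdiff_coeff q (Suc k) 0 * ?f 0 + (\<Sum>i\<le>k. qdiff_coeff q (Suc k) (Suc i) * ?f (Suc i))"
    by (simp only: qdiff_coeff_Suc[OF q] left_diff_distrib sum_subtractf) (simp add: qdiff_coeff_def)
  also have "\<dots> = (\<Sum>i\<le>Suc k. qdiff_coeff q (Suc k) i * ?f i)"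
    by (rule sum.atMost_Suc_shift[symmetric])
  finally show ?case .
qed

subsection \<open>Products of q-binomial series\<close>

text \<open>Each numerator parameter is paired with a denominator parameter. As \<open>map2\<close>
  truncates to the shorter list, lists are first brought to equal length by zeros.\<close>

definition asc_fps_list :: "complex \<Rightarrow> complex list \<Rightarrow> complex list \<Rightarrow> complex fps" where
  "asc_fps_list q A B = prod_list (map2 (asc_fps q) A B)"

lemma asc_fps_list_Nil [simp]: "asc_fps_list q [] [] = 1"
  by (simp add: asc_fps_list_def)

lemma asc_fps_list_Cons [simp]:
  "asc_fps_list q (a # A) (b # B) = asc_fps q a b * asc_fps_list q A B"
  by (simp add: asc_fps_list_def)

lemma qpochs_Nil [simp]: "qpochs [] q n = 1"
  by (simp add: qpochs_def)

lemma qpochs_Cons [simp]: "qpochs (a # as) q n = qpoch a q n * qpochs as q n"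
  by (simp add: qpochs_def)

lemma qpoch_infs_Nil [simp]: "qpoch_infs [] q = 1"
  by (simp add: qpoch_infs_def)

lemma qpoch_infs_Cons [simp]: "qpoch_infs (a # as) q = qpoch_inf a q * qpoch_infs as q"
  by (simp add: qpoch_infs_def)

lemma eval_asc_fps_list:
  assumes q: "norm q < 1" and "length A = length B" "\<And>b. b \<in> set B \<Longrightarrow> norm (b * z) < 1"
  shows "ereal (norm z) < fps_conv_radius (asc_fps_list q A B)"
    and "eval_fps (asc_fps_list q A B) z
       = qpoch_infs (map (\<lambda>a. a * z) A) q / qpoch_infs (map (\<lambda>b. b * z) B) q"
proof -
  have "ereal (norm z) < fps_conv_radius (asc_fps_list q A B) \<and> eval_fps (asc_fps_list q A B) z
       = qpoch_infs (map (\<lambda>a. a * z) A) q / qpoch_infs (map (\<lambda>b. b * z) B) q"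
    using assms(2,3)
  proof (induction A B rule: list_induct2)
    case (Cons a A b B)
    have "norm (b * z) < 1" using Cons.prems by simp
    moreover from this have "ereal (norm z) < fps_conv_radius (asc_fps q a b)"
      by (rule norm_less_conv_radius_asc_fps[OF q])
    ultimately show ?case using Cons
      by (auto simp: eval_fps_mult eval_asc_fps[OF q] intro!: order.strict_trans2[OF _ fps_conv_radius_mult])
  qed simp
  then show "ereal (norm z) < fps_conv_radius (asc_fps_list q A B)"
    and "eval_fps (asc_fps_list q A B) z
       = qpoch_infs (map (\<lambda>a. a * z) A) q / qpoch_infs (map (\<lambda>b. b * z) B) q"
    by auto
qed

lemma has_fps_expansion_asc_fps_list:
  assumes q: "norm q < 1" and "length A = length B"
  shows "(\<lambda>z. qpoch_infs (map (\<lambda>a. a * z) A) q / qpoch_infs (map (\<lambda>b. b * z) B) q)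
           has_fps_expansion asc_fps_list q A B"
  unfolding has_fps_expansion_def
proof
  show "0 < fps_conv_radius (asc_fps_list q A B)"
    using eval_asc_fps_list(1)[OF assms, of 0] by (simp add: zero_ereal_def)
  have "\<forall>\<^sub>F z in nhds 0. norm (b * z) < 1" for b :: complex
  proof -
    have "((\<lambda>z. norm (b * z)) \<longlongrightarrow> norm (b * 0)) (nhds 0)"
      by (intro tendsto_intros filterlim_ident)
    then show ?thesis by (intro order_tendstoD(2)) auto
  qed
  then have "\<forall>\<^sub>F z in nhds 0. \<forall>b\<in>set B. norm (b * z) < 1"
    by (simp add: eventually_ball_finite)
  then show "\<forall>\<^sub>F z in nhds 0. eval_fps (asc_fps_list q A B) z
      = qpoch_infs (map (\<lambda>a. a * z) A) q / qpoch_infs (map (\<lambda>b. b * z) B) q"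
    by eventually_elim (rule eval_asc_fps_list(2)[OF assms], auto)
qed

lemma al_salam_carlitz_eq:
  assumes q: "norm q < 1"
    and "(\<lambda>z. qpoch_infs (map (\<lambda>a. a * z) A) q / qpoch_infs (map (\<lambda>b. b * z) B) q) has_fps_expansion F"
  shows "al_salam_carlitz q A B n = qpoch q q n * fps_nth F n"
proof -
  have "Abs_fps (\<lambda>n. al_salam_carlitz q A B n / qpoch q q n) = F"
    using al_salam_carlitz_fps_expansion[OF q] assms(2) by (rule fps_expansion_unique_complex)
  then show ?thesis
    using qpoch_q_q_nonzero[OF q] by auto
qed

text \<open>Both sides expand (a z; q)_inf / ((x z; q)_inf (y z; q)_inf), which is symmetric in x
  and y.\<close>

lemma asc_fps_swap:
  assumes q: "norm q < 1"
  shows "asc_fps q a y * asc_fps q 0 x = asc_fps q a x * asc_fps q 0 y"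
proof -
  have "asc_fps_list q [a, 0] [y, x] = asc_fps_list q [a, 0] [x, y]"
    using has_fps_expansion_asc_fps_list[OF q, of "[a, 0]" "[y, x]"]
      has_fps_expansion_asc_fps_list[OF q, of "[a, 0]" "[x, y]"]
    by (intro fps_expansion_unique_complex) (simp_all add: mult_ac)
  then show ?thesis by simp
qed

section \<open>Series of q-derivatives\<close>

lemma between_conv_radius:
  assumes "ereal (norm z) < fps_conv_radius F" "ereal (norm w) < fps_conv_radius F"
  obtains r where "norm z < r" "norm w < r" "r > 0" "ereal r < fps_conv_radius F"
proof -
  have "ereal (max (norm z) (norm w)) < fps_conv_radius F"
    using assms by (simp add: max_def)
  then obtain r where "max (norm z) (norm w) < r" "ereal r < fps_conv_radius F"
    using ereal_dense2 by (metis ereal_less_eq(3) less_ereal.simps(1))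
  then show thesis
    using le_less_trans[OF norm_ge_zero[of z], of r] by (intro that[of r]) auto
qed

text \<open>Write the coefficient of the product as a Cauchy sum over n = k + i. The q-binomial
  coefficient joins the coefficient of \<open>F\<close> to give that of its k-th q-derivative, and
  summing over i first evaluates this at x t.\<close>

lemma asc_series_conv_qderiv:
  assumes q: "norm q < 1" and y: "y \<noteq> 0"
    and F: "ereal (norm (x * t)) < fps_conv_radius F" "ereal (norm (y * t)) < fps_conv_radius F"
  obtains A where
    "(\<lambda>n. qpoch q q n * fps_nth (asc_fps q a y * asc_fps q 0 x) n * fps_nth F n * t ^ n) sums A"
    "(\<lambda>k. hqpoch q a y k * t ^ k * eval_fps (qderiv_div q k F) (x * t)) sums A"
proof -
  obtain r where r: "norm (x * t) < r" "norm (y * t) < r" "r > 0" "ereal r < fps_conv_radius F"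
    using between_conv_radius[OF F] by blast
  obtain M where M: "M \<ge> 0" "\<And>n k. norm (fps_nth (qderiv_div q k F) n) \<le> M / r ^ (n + k)"
    using qderiv_div_coeff_bound[OF q r(3,4)] by blast
  obtain N where N: "N \<ge> 0" "\<And>k. norm (hqpoch q a y k) \<le> N * norm y ^ k"
    using hqpoch_bounded[OF q, of y "norm y" a] y by auto
  define f where "f = (\<lambda>k i. hqpoch q a y k * t ^ k * (fps_nth (qderiv_div q k F) i * (x * t) ^ i))"
  have bound: "norm (f k i) \<le> N * M * (norm (y * t) / r) ^ k * (norm (x * t) / r) ^ i" for k i
  proof -
    have "norm (f k i) \<le> (N * norm y ^ k) * norm t ^ k * (M / r ^ (i + k) * norm (x * t) ^ i)"
      unfolding f_def norm_mult[of "_ * _" "_ * _"] norm_mult[of "hqpoch _ _ _ _"]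
        norm_mult[of "fps_nth _ _"] norm_power[of _ k] norm_power[of _ i]
      by (intro mult_mono M N) (use M N r in auto)
    then show ?thesis
      by (simp add: power_add norm_mult power_mult_distrib power_divide mult_ac)
  qed
  have small: "0 \<le> norm (y * t) / r" "norm (y * t) / r < 1" "0 \<le> norm (x * t) / r" "norm (x * t) / r < 1"
    using r by auto
  obtain A where A: "(\<lambda>n. \<Sum>k\<le>n. f k (n - k)) sums A" "(\<lambda>k. \<Sum>i. f k i) sums A"
    by (rule sums_triangle[OF small bound])
  have "(\<Sum>k\<le>n. f k (n - k))
      = qpoch q q n * fps_nth (asc_fps q a y * asc_fps q 0 x) n * fps_nth F n * t ^ n" for n
  proof -
    have "f k (n - k) = qpoch q q n * (fps_nth (asc_fps q a y) k * fps_nth (asc_fps q 0 x) (n - k)) * fps_nth F n * t ^ n"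
      if "k \<le> n" for k
    proof -
      have "t ^ n = t ^ k * t ^ (n - k)" using that by (simp flip: power_add)
      then show ?thesis
        using that by (simp add: f_def qderiv_div_def asc_fps_def power_mult_distrib mult_ac)
    qed
    then show ?thesis
      by (simp add: fps_mult_nth sum_distrib_left sum_distrib_right atLeast0AtMost)
  qed
  moreover have "(\<Sum>i. f k i) = hqpoch q a y k * t ^ k * eval_fps (qderiv_div q k F) (x * t)" for k
    unfolding f_def eval_fps_def
    by (rule suminf_mult, rule summable_fps, rule order.strict_trans2[OF F(1) fps_conv_radius_qderiv_div[OF q]])
  ultimately show thesis
    using A that[of A] by simp
qed

text \<open>Apply the Leibniz rule termwise, put k = l + i and split \<open>hqpoch\<close> at l. The
  inner sum keeps the original shape, with \<open>a\<close> and \<open>z\<close> both multiplied by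
  q^l.\<close>

lemma qderiv_series_mult:
  assumes q: "norm q < 1" and y: "y \<noteq> 0"
    and F: "ereal (norm z) < fps_conv_radius F" "ereal (norm (y * t)) < fps_conv_radius F"
    and G: "ereal (norm z) < fps_conv_radius G" "ereal (norm (y * t)) < fps_conv_radius G"
  obtains A where
    "(\<lambda>k. hqpoch q a y k * t ^ k * eval_fps (qderiv_div q k (F * G)) z) sums A"
    "(\<lambda>l. hqpoch q a y l * t ^ l * eval_fps (qderiv_div q l F) z
        * (\<Sum>i. hqpoch q (a * q ^ l) y i * t ^ i * eval_fps (qderiv_div q i G) (q ^ l * z))) sums A"
proof -
  obtain r where r: "norm z < r" "norm (y * t) < r" "r > 0" "ereal r < fps_conv_radius F"
    using between_conv_radius[OF F] by blast
  obtain r' where r': "norm z < r'" "norm (y * t) < r'" "r' > 0" "ereal r' < fps_conv_radius G"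
    using between_conv_radius[OF G] by blast
  obtain M where M: "M \<ge> 0" "\<And>k w. norm w \<le> norm z \<Longrightarrow> norm (eval_fps (qderiv_div q k F) w) \<le> M / r ^ k"
    using eval_qderiv_div_bound[OF q norm_ge_zero r(1,4)] by blast
  obtain M' where M': "M' \<ge> 0" "\<And>k w. norm w \<le> norm z \<Longrightarrow> norm (eval_fps (qderiv_div q k G) w) \<le> M' / r' ^ k"
    using eval_qderiv_div_bound[OF q norm_ge_zero r'(1,4)] by blast
  obtain N where N: "N \<ge> 0" "\<And>k. norm (hqpoch q a y k) \<le> N * norm y ^ k"
    using hqpoch_bounded[OF q, of y "norm y" a] y by auto
  define f where "f = (\<lambda>l i. hqpoch q a y (l + i) * t ^ (l + i)
      * (eval_fps (qderiv_div q l F) z * eval_fps (qderiv_div q i G) (q ^ l * z)))"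
  have qz: "norm (q ^ l * z) \<le> norm z" for l
    using q by (simp add: norm_mult norm_power mult_left_le_one_le power_le_one)
  have bound: "norm (f l i) \<le> N * M * M' * (norm (y * t) / r) ^ l * (norm (y * t) / r') ^ i" for l i
  proof -
    have "norm (f l i) \<le> (N * norm y ^ (l + i)) * norm t ^ (l + i) * ((M / r ^ l) * (M' / r' ^ i))"
      unfolding f_def norm_mult[of "_ * _" "_ * _"] norm_mult[of "hqpoch _ _ _ _"]
        norm_mult[of "eval_fps _ _"] norm_power[of _ "l + i"]
      by (intro mult_mono M M' N qz) (use M M' N r r' in auto)
    then show ?thesis
      by (simp add: power_add norm_mult power_mult_distrib power_divide mult_ac)
  qed
  have small: "0 \<le> norm (y * t) / r" "norm (y * t) / r < 1" "0 \<le> norm (y * t) / r'" "norm (y * t) / r' < 1"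
    using r r' by auto
  obtain A where A: "(\<lambda>n. \<Sum>k\<le>n. f k (n - k)) sums A" "(\<lambda>k. \<Sum>i. f k i) sums A"
      "\<And>k. summable (f k)"
    using sums_triangle[OF small bound] by blast
  have "(\<Sum>l\<le>k. f l (k - l)) = hqpoch q a y k * t ^ k * eval_fps (qderiv_div q k (F * G)) z" for k
    unfolding eval_qderiv_div_mult[OF q F(1) G(1)] sum_distrib_left
    by (intro sum.cong) (auto simp: f_def)
  moreover have "(\<Sum>i. f l i) = hqpoch q a y l * t ^ l * eval_fps (qderiv_div q l F) z
        * (\<Sum>i. hqpoch q (a * q ^ l) y i * t ^ i * eval_fps (qderiv_div q i G) (q ^ l * z))" for l
  proof -
    let ?c = "hqpoch q a y l * t ^ l * eval_fps (qderiv_div q l F) z"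
    let ?g = "\<lambda>i. hqpoch q (a * q ^ l) y i * t ^ i * eval_fps (qderiv_div q i G) (q ^ l * z)"
    have f: "f l = (\<lambda>i. ?c * ?g i)"
      by (simp add: f_def hqpoch_add power_add mult_ac)
    show ?thesis
    \<comment> \<open>Summability of the inner series can be read off from that of
      \<open>f l\<close> only when the constant is nonzero; otherwise both sides are 0 whatever the
      inner series does.\<close>
    proof (cases "?c = 0")
      case False
      then have "summable ?g"
        using A(3)[of l] unfolding f summable_cmult_iff by blast
      then show ?thesis
        unfolding f by (rule suminf_mult)
    next
      case True
      then show ?thesis
        unfolding f by (simp only: mult_zero_left suminf_zero)
    qed
  qed
  ultimately show thesis
    using A that[of A] by simp
qed

subsection \<open>The bilinear generating function\<close>

lemma qpoch_inf_shift:
  assumes "norm q < 1" "\<And>k. a * q ^ k \<noteq> 1"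
  shows "qpoch_inf (a * q ^ n) q = qpoch_inf a q / qpoch a q n"
  using qpoch_inf_split[OF assms(1), of a n] assms(2) by (simp add: qpoch_eq_0_iff)

lemma qpoch_infs_shift:
  assumes "norm q < 1" "\<And>a k. a \<in> set as \<Longrightarrow> a * q ^ k \<noteq> 1"
  shows "qpoch_infs (map (\<lambda>a. a * q ^ n) as) q = qpoch_infs as q / qpochs as q n"
  using assms(2) by (induction as) (simp_all add: qpoch_inf_shift assms(1))

lemma basic_hyp_balanced:
  assumes "length as = Suc (length bs)"
  shows "basic_hyp as bs q z = (\<Sum>n. qpochs as q n / qpochs (q # bs) q n * z ^ n)"
  using assms by (simp add: basic_hyp_def)

text \<open>Swapping \<open>x\<close> and \<open>y\<close> before applying the Leibniz rule makes the innermost sum a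
  \<open>q\<close>-binomial series.\<close>

lemma asc_kernel_sums:
  fixes a b x y t u v q :: complex
  assumes q: "norm q < 1" and nz: "x \<noteq> 0" "y \<noteq> 0" "u \<noteq> 0"
    and den: "\<And>k. a * v * t * q ^ k \<noteq> 1" "\<And>k. b * y * t * q ^ k \<noteq> 1"
    and conv: "norm (x * u * t) < 1" "norm (x * v * t) < 1" "norm (y * u * t) < 1" "norm (y * v * t) < 1"
  shows "(\<lambda>i. hqpoch q a y i * t ^ i
             * eval_fps (qderiv_div q i (asc_fps q b u * asc_fps q 0 v)) (x * t))
         sums (qpoch_inf (a * v * t) q * qpoch_inf (b * y * t) q
                 / (qpoch_inf (x * v * t) q * qpoch_inf (y * u * t) q * qpoch_inf (y * v * t) q)
               * basic_hyp [a / x, b / u, y * v * t] [a * v * t, b * y * t] q (x * u * t))"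
proof -
  let ?G = "asc_fps q b u * asc_fps q 0 v"
  let ?P = "qpoch_inf (a * v * t) q * qpoch_inf (b * y * t) q
                 / (qpoch_inf (x * v * t) q * qpoch_inf (y * u * t) q * qpoch_inf (y * v * t) q)"
  have comm: "norm (u * (x * t)) < 1" "norm (v * (x * t)) < 1" "norm (u * (y * t)) < 1" "norm (v * (y * t)) < 1"
    using conv by (simp_all add: mult_ac)
  have rad: "ereal (norm (x * t)) < fps_conv_radius (asc_fps q b u)"
       "ereal (norm (x * t)) < fps_conv_radius (asc_fps q 0 v)"
       "ereal (norm (y * t)) < fps_conv_radius (asc_fps q b u)"
       "ereal (norm (y * t)) < fps_conv_radius (asc_fps q 0 v)"
    by (intro norm_less_conv_radius_asc_fps q comm)+
  have radG: "ereal (norm (x * t)) < fps_conv_radius ?G" "ereal (norm (y * t)) < fps_conv_radius ?G"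
    using rad by (auto intro: order.strict_trans2[OF _ fps_conv_radius_mult])
  obtain A where A:
    "(\<lambda>n. qpoch q q n * fps_nth (asc_fps q a y * asc_fps q 0 x) n * fps_nth ?G n * t ^ n) sums A"
    "(\<lambda>k. hqpoch q a y k * t ^ k * eval_fps (qderiv_div q k ?G) (x * t)) sums A"
    using asc_series_conv_qderiv[OF q nz(2) radG] by blast
  obtain A' where A':
    "(\<lambda>n. qpoch q q n * fps_nth (asc_fps q a x * asc_fps q 0 y) n * fps_nth ?G n * t ^ n) sums A'"
    "(\<lambda>k. hqpoch q a x k * t ^ k * eval_fps (qderiv_div q k ?G) (y * t)) sums A'"
    using asc_series_conv_qderiv[OF q nz(1) radG(2,1)] by blast
  \<comment> \<open>By symmetry of the kernel, the expansions at x t and at y t come from the same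
    single series.\<close>
  have "A' = A"
    using A(1) A'(1) unfolding asc_fps_swap[OF q, of a x y] by (rule sums_unique2[symmetric])
  obtain A'' where A'':
    "(\<lambda>k. hqpoch q a x k * t ^ k * eval_fps (qderiv_div q k ?G) (y * t)) sums A''"
    "(\<lambda>l. hqpoch q a x l * t ^ l * eval_fps (qderiv_div q l (asc_fps q b u)) (y * t)
        * (\<Sum>i. hqpoch q (a * q ^ l) x i * t ^ i * eval_fps (qderiv_div q i (asc_fps q 0 v)) (q ^ l * (y * t)))) sums A''"
    using qderiv_series_mult[OF q nz(1) rad(3,1,4,2)] by blast
  have "A'' = A"
    using A''(1) A'(2) \<open>A' = A\<close> sums_unique2 by metis
  define h where "h = (\<lambda>l. qpochs [a / x, b / u, y * v * t] q l / qpochs (q # [a * v * t, b * y * t]) q l * (x * u * t) ^ l)"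
  have "hqpoch q a x l * t ^ l * eval_fps (qderiv_div q l (asc_fps q b u)) (y * t)
        * (\<Sum>i. hqpoch q (a * q ^ l) x i * t ^ i * eval_fps (qderiv_div q i (asc_fps q 0 v)) (q ^ l * (y * t)))
      = ?P * h l" for l
  proof -
    have le: "norm (v * (q ^ l * (y * t))) < 1"
      using norm_mult_power_less_1[OF q comm(4), of l] by (simp add: mult_ac)
    have xv: "norm (x * (v * t)) < 1" using conv(2) by (simp add: mult_ac)
    \<comment> \<open>With numerator parameter 0 the i-th q-derivative depends on i only through v^i
      / (q; q)_i, so the sum over i becomes \<open>asc_fps q (a * q ^ l) x\<close> at v t.\<close>
    have "hqpoch q (a * q ^ l) x i * t ^ i * eval_fps (qderiv_div q i (asc_fps q 0 v)) (q ^ l * (y * t))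
        = inverse (qpoch_inf (v * (q ^ l * (y * t))) q) * (fps_nth (asc_fps q (a * q ^ l) x) i * (v * t) ^ i)" for i
      using eval_qderiv_div_asc_fps[OF q le, of i 0]
      by (simp add: asc_fps_def power_mult_distrib field_simps)
    then have "(\<Sum>i. hqpoch q (a * q ^ l) x i * t ^ i * eval_fps (qderiv_div q i (asc_fps q 0 v)) (q ^ l * (y * t)))
        = inverse (qpoch_inf (v * (q ^ l * (y * t))) q) * (\<Sum>i. fps_nth (asc_fps q (a * q ^ l) x) i * (v * t) ^ i)"
      using norm_less_conv_radius_asc_fps[OF q xv] by (simp add: suminf_mult summable_fps)
    also have "(\<Sum>i. fps_nth (asc_fps q (a * q ^ l) x) i * (v * t) ^ i)
        = qpoch_inf (a * q ^ l * (v * t)) q / qpoch_inf (x * (v * t)) q"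
      using eval_asc_fps[OF q xv] by (simp add: eval_fps_def)
    also have "qpoch_inf (v * (q ^ l * (y * t))) q = qpoch_inf (y * v * t) q / qpoch (y * v * t) q l"
      using qpoch_inf_shift[OF q mult_power_neq_1[OF q conv(4)], of l] by (simp add: mult_ac)
    also have "qpoch_inf (a * q ^ l * (v * t)) q = qpoch_inf (a * v * t) q / qpoch (a * v * t) q l"
      using qpoch_inf_shift[OF q den(1), of l] by (simp add: mult_ac)
    finally have inner: "(\<Sum>i. hqpoch q (a * q ^ l) x i * t ^ i * eval_fps (qderiv_div q i (asc_fps q 0 v)) (q ^ l * (y * t)))
        = inverse (qpoch_inf (y * v * t) q / qpoch (y * v * t) q l)
          * (qpoch_inf (a * v * t) q / qpoch (a * v * t) q l / qpoch_inf (x * v * t) q)"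
      by (simp add: mult_ac)
    have "qpoch_inf (b * q ^ l * (y * t)) q = qpoch_inf (b * y * t) q / qpoch (b * y * t) q l"
      using qpoch_inf_shift[OF q den(2), of l] by (simp add: mult_ac)
    then have outer: "eval_fps (qderiv_div q l (asc_fps q b u)) (y * t)
        = u ^ l * qpoch (b / u) q l / qpoch q q l
          * (qpoch_inf (b * y * t) q / qpoch (b * y * t) q l / qpoch_inf (y * u * t) q)"
      using eval_qderiv_div_asc_fps[OF q comm(3), of l b] nz by (simp add: hqpoch_conv_qpoch mult_ac)
    show ?thesis
      unfolding inner outer h_def using nz
      by (simp add: hqpoch_conv_qpoch power_mult_distrib mult_ac)
  qed
  then have sums: "(\<lambda>l. ?P * h l) sums A"
    using A''(2) \<open>A'' = A\<close> by simp
  \<comment> \<open>Dividing by the nonzero prefactor yields genuine convergence of the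
    hypergeometric series.\<close>
  moreover have "?P \<noteq> 0"
    using qpoch_inf_nonzero[OF q den(1)] qpoch_inf_nonzero[OF q den(2)] qpoch_inf_nonzero'[OF q conv(2)]
      qpoch_inf_nonzero'[OF q conv(3)] qpoch_inf_nonzero'[OF q conv(4)] by simp
  ultimately have "summable h"
    by (metis sums_summable summable_cmult_iff)
  then have "(\<lambda>l. ?P * h l) sums (?P * suminf h)"
    by (intro sums_mult summable_sums)
  with sums have "A = ?P * suminf h"
    by (rule sums_unique2)
  also have "suminf h = basic_hyp [a / x, b / u, y * v * t] [a * v * t, b * y * t] q (x * u * t)"
    by (simp add: basic_hyp_balanced h_def)
  finally show ?thesis using A(2) by simp
qed

text \<open>In the q-difference formula, passing from z to q^i z changes the quotient of infinite
  products by a quotient of finite q-shifted factorials, which is the remaining part of the i-th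
  hypergeometric term.\<close>

lemma qderiv_div_asc_fps_list_conv_basic_hyp:
  assumes q: "q \<noteq> 0" "norm q < 1" and len: "length C = length D"
    and den: "\<And>c k. c \<in> set C \<Longrightarrow> c * z * q ^ k \<noteq> 1"
    and conv: "\<And>d. d \<in> set D \<Longrightarrow> norm (d * z) < 1"
  shows "qpoch q q n * z ^ n * eval_fps (qderiv_div q n (asc_fps_list q C D)) z
       = qpoch_infs (map (\<lambda>c. c * z) C) q / qpoch_infs (map (\<lambda>d. d * z) D) q
         * basic_hyp (q powi (- int n) # map (\<lambda>d. d * z) D) (map (\<lambda>c. c * z) C) q q"
proof -
  let ?Cz = "map (\<lambda>c. c * z) C" and ?Dz = "map (\<lambda>d. d * z) D"
  have ev: "eval_fps (asc_fps_list q C D) (q ^ i * z)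
      = qpoch_infs ?Cz q / qpoch_infs ?Dz q * (qpochs ?Dz q i / qpochs ?Cz q i)" for i
  proof -
    have le: "norm (d * (q ^ i * z)) < 1" if "d \<in> set D" for d
      using norm_mult_power_less_1[OF q(2) conv[OF that], of i] by (simp add: mult_ac)
    have "qpoch_infs (map (\<lambda>a. a * q ^ i) ?Cz) q = qpoch_infs ?Cz q / qpochs ?Cz q i"
      by (rule qpoch_infs_shift[OF q(2)]) (use den in auto)
    then have "qpoch_infs (map (\<lambda>c. c * (q ^ i * z)) C) q = qpoch_infs ?Cz q / qpochs ?Cz q i"
      by (simp add: o_def mult_ac)
    moreover have "qpoch_infs (map (\<lambda>a. a * q ^ i) ?Dz) q = qpoch_infs ?Dz q / qpochs ?Dz q i"
      by (rule qpoch_infs_shift[OF q(2)]) (use mult_power_neq_1[OF q(2) conv] in auto)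
    then have "qpoch_infs (map (\<lambda>d. d * (q ^ i * z)) D) q = qpoch_infs ?Dz q / qpochs ?Dz q i"
      by (simp add: o_def mult_ac)
    ultimately show ?thesis
      using eval_asc_fps_list(2)[OF q(2) len le] by simp
  qed
  have "basic_hyp (q powi (- int n) # ?Dz) ?Cz q q
      = (\<Sum>i. qdiff_coeff q n i * (qpochs ?Dz q i / qpochs ?Cz q i))"
    using len by (subst basic_hyp_balanced) (simp_all add: qdiff_coeff_def mult_ac)
  also have "\<dots> = (\<Sum>i\<le>n. qdiff_coeff q n i * (qpochs ?Dz q i / qpochs ?Cz q i))"
    by (rule suminf_finite) (use q in \<open>auto simp: qdiff_coeff_def qpoch_neg_power_eq_0\<close>)
  finally have hyp: "basic_hyp (q powi (- int n) # ?Dz) ?Cz q q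
      = (\<Sum>i\<le>n. qdiff_coeff q n i * (qpochs ?Dz q i / qpochs ?Cz q i))" .
  have "qpoch q q n * z ^ n * eval_fps (qderiv_div q n (asc_fps_list q C D)) z
      = (\<Sum>i\<le>n. qdiff_coeff q n i * eval_fps (asc_fps_list q C D) (q ^ i * z))"
    by (rule eval_qderiv_div_conv_sum[OF q eval_asc_fps_list(1)[OF q(2) len conv]])
  then show ?thesis
    unfolding hyp ev sum_distrib_left by (simp only: mult_ac)
qed

text \<open>The witness \<open>S\<close> together with \<open>sums\<close> asserts that both outer
  series converge, beyond an equation between \<open>suminf\<close> values. \<open>nonzero\<close>
  covers the divisions by x, y and lam2, and \<open>convergence\<close> places x t and y t inside
  the disc of convergence of the second generating function.\<close>

theorem theorem2p3:
  fixes q \<alpha> \<beta> x y lam2 lam3 t :: complex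
    and C D :: "complex list" and m :: nat
  assumes q: "q \<noteq> 0" "norm q < 1"
    and lengths: "length C = m" "length D = m"
    and nonzero: "x \<noteq> 0" "y \<noteq> 0" "lam2 \<noteq> 0"
    and denominators:
      "\<And>k. \<alpha> * lam3 * t * q ^ k \<noteq> 1"
      "\<And>k. \<beta> * y * t * q ^ k \<noteq> 1"
      "\<And>k c. c \<in> set C \<Longrightarrow> c * x * t * q ^ k \<noteq> 1"
    and convergence:
      "\<And>u v. u \<in> {x, y} \<Longrightarrow> v \<in> {lam2, lam3} \<union> set D \<Longrightarrow> norm (u * v * t) < 1"
  shows
    "\<exists>S. (\<lambda>n. qpochs [\<alpha> / y, x * lam3 * t] q n / qpochs [q, \<alpha> * lam3 * t] q n * (y / x) ^ n
              * basic_hyp (q powi (- int n) # map (\<lambda>d. d * x * t) D) (map (\<lambda>c. c * x * t) C) q q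
              * basic_hyp [\<alpha> / x, \<beta> / lam2, y * lam3 * t] [\<alpha> * lam3 * t * q ^ n, \<beta> * y * t] q
                  (x * lam2 * t * q ^ n)) sums S
       \<and> (\<lambda>n. al_salam_carlitz q [\<alpha>] [x, y] n
              * al_salam_carlitz q (\<beta> # C) ([lam2, lam3] @ D) n * t ^ n / qpoch q q n) sums
           (qpoch_infs ([\<alpha> * lam3 * t, \<beta> * y * t] @ map (\<lambda>c. c * x * t) C) q
            / qpoch_infs ([x * lam3 * t, y * lam2 * t, y * lam3 * t] @ map (\<lambda>d. d * x * t) D) q * S)"
proof -
  let ?G = "asc_fps q \<beta> lam2 * asc_fps q 0 lam3" and ?H = "asc_fps_list q C D"
  let ?Cz = "map (\<lambda>c. c * x * t) C" and ?Dz = "map (\<lambda>d. d * x * t) D"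
  let ?N = "qpoch_infs ([\<alpha> * lam3 * t, \<beta> * y * t] @ ?Cz) q
            / qpoch_infs ([x * lam3 * t, y * lam2 * t, y * lam3 * t] @ ?Dz) q"
  define s where "s = (\<lambda>n. qpochs [\<alpha> / y, x * lam3 * t] q n / qpochs [q, \<alpha> * lam3 * t] q n * (y / x) ^ n
              * basic_hyp (q powi (- int n) # ?Dz) ?Cz q q
              * basic_hyp [\<alpha> / x, \<beta> / lam2, y * lam3 * t] [\<alpha> * lam3 * t * q ^ n, \<beta> * y * t] q
                  (x * lam2 * t * q ^ n))"
  have len: "length C = length D" using lengths by simp
  have conv: "norm (v * (u * t)) < 1" if "u \<in> {x, y}" "v \<in> {lam2, lam3} \<union> set D" for u v
    using convergence[OF that] by (simp add: mult_ac)
  have radG: "ereal (norm (u * t)) < fps_conv_radius ?G" if "u \<in> {x, y}" for u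
    using conv[OF that] norm_less_conv_radius_asc_fps[OF q(2)]
    by (intro order.strict_trans2[OF _ fps_conv_radius_mult]) simp
  have radH: "ereal (norm (u * t)) < fps_conv_radius ?H" if "u \<in> {x, y}" for u
    using conv[OF that] by (intro eval_asc_fps_list(1)[OF q(2) len]) simp
  have rad: "ereal (norm (u * t)) < fps_conv_radius (?H * ?G)" if "u \<in> {x, y}" for u
    using radG[OF that] radH[OF that] by (intro order.strict_trans2[OF _ fps_conv_radius_mult]) simp
  have xy: "x \<in> {x, y}" "y \<in> {x, y}" by auto
  obtain A where A:
    "(\<lambda>n. qpoch q q n * fps_nth (asc_fps q \<alpha> y * asc_fps q 0 x) n * fps_nth (?H * ?G) n * t ^ n) sums A"
    "(\<lambda>k. hqpoch q \<alpha> y k * t ^ k * eval_fps (qderiv_div q k (?H * ?G)) (x * t)) sums A"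
    using asc_series_conv_qderiv[OF q(2) nonzero(2) rad[OF xy(1)] rad[OF xy(2)]] by blast
  \<comment> \<open>The C, D part comes first in the Leibniz rule, so it is q-differentiated at x t
    itself and only the other factor moves to q^n x t.\<close>
  obtain A' where A':
    "(\<lambda>k. hqpoch q \<alpha> y k * t ^ k * eval_fps (qderiv_div q k (?H * ?G)) (x * t)) sums A'"
    "(\<lambda>n. hqpoch q \<alpha> y n * t ^ n * eval_fps (qderiv_div q n ?H) (x * t)
        * (\<Sum>i. hqpoch q (\<alpha> * q ^ n) y i * t ^ i * eval_fps (qderiv_div q i ?G) (q ^ n * (x * t)))) sums A'"
    using qderiv_series_mult[OF q(2) nonzero(2) radH[OF xy(1)] radH[OF xy(2)] radG[OF xy(1)] radG[OF xy(2)]]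
    by blast
  have "A' = A" using A(2) A'(1) by (rule sums_unique2[symmetric])
  have "hqpoch q \<alpha> y n * t ^ n * eval_fps (qderiv_div q n ?H) (x * t)
        * (\<Sum>i. hqpoch q (\<alpha> * q ^ n) y i * t ^ i * eval_fps (qderiv_div q i ?G) (q ^ n * (x * t)))
      = ?N * s n" for n
  proof -
    let ?BH1 = "basic_hyp (q powi (- int n) # ?Dz) ?Cz q q"
    let ?BH2 = "basic_hyp [\<alpha> / x, \<beta> / lam2, y * lam3 * t] [\<alpha> * lam3 * t * q ^ n, \<beta> * y * t] q
                  (x * lam2 * t * q ^ n)"
    have qn: "norm (x * q ^ n * v * t) < 1" if "v \<in> {lam2, lam3}" for v
      using norm_mult_power_less_1[OF q(2) convergence[of x v], of n] that by (auto simp: mult_ac)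
    have den: "\<alpha> * q ^ n * lam3 * t * q ^ k \<noteq> 1" for k
      using denominators(1)[of "n + k"] by (simp add: power_add mult_ac)
    \<comment> \<open>The kernel formula is used with alpha q^n and x q^n. Their quotient is still
      alpha / x, while the shifted infinite products release the finite factors of the outer
      series.\<close>
    have "(\<Sum>i. hqpoch q (\<alpha> * q ^ n) y i * t ^ i * eval_fps (qderiv_div q i ?G) (x * q ^ n * t))
        = qpoch_inf (\<alpha> * q ^ n * lam3 * t) q * qpoch_inf (\<beta> * y * t) q
            / (qpoch_inf (x * q ^ n * lam3 * t) q * qpoch_inf (y * lam2 * t) q * qpoch_inf (y * lam3 * t) q)
          * basic_hyp [\<alpha> * q ^ n / (x * q ^ n), \<beta> / lam2, y * lam3 * t] [\<alpha> * q ^ n * lam3 * t, \<beta> * y * t] q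
              (x * q ^ n * lam2 * t)"
      using q nonzero den denominators(2) qn convergence
      by (intro sums_unique[symmetric] asc_kernel_sums) auto
    moreover have "qpoch_inf (\<alpha> * q ^ n * lam3 * t) q = qpoch_inf (\<alpha> * lam3 * t) q / qpoch (\<alpha> * lam3 * t) q n"
      using qpoch_inf_shift[OF q(2) denominators(1), of n] by (simp add: mult_ac)
    moreover have "qpoch_inf (x * q ^ n * lam3 * t) q = qpoch_inf (x * lam3 * t) q / qpoch (x * lam3 * t) q n"
      using qpoch_inf_shift[OF q(2) mult_power_neq_1[OF q(2) convergence[of x lam3]], of n]
      by (simp add: mult_ac)
    moreover have "\<alpha> * q ^ n / (x * q ^ n) = \<alpha> / x" "\<alpha> * q ^ n * lam3 * t = \<alpha> * lam3 * t * q ^ n"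
        "x * q ^ n * lam2 * t = x * lam2 * t * q ^ n" "x * q ^ n * t = q ^ n * (x * t)"
      using q by (simp_all add: mult_ac)
    ultimately have inner: "(\<Sum>i. hqpoch q (\<alpha> * q ^ n) y i * t ^ i * eval_fps (qderiv_div q i ?G) (q ^ n * (x * t)))
        = (qpoch_inf (\<alpha> * lam3 * t) q / qpoch (\<alpha> * lam3 * t) q n) * qpoch_inf (\<beta> * y * t) q
            / ((qpoch_inf (x * lam3 * t) q / qpoch (x * lam3 * t) q n)
               * qpoch_inf (y * lam2 * t) q * qpoch_inf (y * lam3 * t) q) * ?BH2"
      by (simp only:)
    have H: "qpoch q q n * (x * t) ^ n * eval_fps (qderiv_div q n ?H) (x * t)
        = qpoch_infs ?Cz q / qpoch_infs ?Dz q * ?BH1"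
      using qderiv_div_asc_fps_list_conv_basic_hyp[OF q len, of "x * t" n] denominators(3) conv
      by (simp add: mult.assoc)
    \<comment> \<open>Splitting (y t)^n as (y/x)^n (x t)^n provides the power of x t demanded by the
      q-difference formula.\<close>
    have h: "hqpoch q \<alpha> y n * t ^ n = qpoch (\<alpha> / y) q n * (y / x) ^ n * (x * t) ^ n"
      using nonzero by (simp add: hqpoch_conv_qpoch power_mult_distrib power_divide)
    have outer: "hqpoch q \<alpha> y n * t ^ n * eval_fps (qderiv_div q n ?H) (x * t)
        = qpoch (\<alpha> / y) q n * (y / x) ^ n / qpoch q q n * (qpoch_infs ?Cz q / qpoch_infs ?Dz q * ?BH1)"
      unfolding h H[symmetric] using qpoch_q_q_nonzero[OF q(2), of n] by (simp add: mult_ac)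
    show ?thesis
      unfolding inner outer s_def by (simp add: mult_ac)
  qed
  then have sums: "(\<lambda>n. ?N * s n) sums A"
    using A'(2) \<open>A' = A\<close> by simp
  have "qpoch_infs ?Cz q \<noteq> 0"
    using qpoch_inf_nonzero[OF q(2) denominators(3)] by (auto simp: qpoch_infs_def prod_list_zero_iff)
  moreover have "qpoch_infs ?Dz q \<noteq> 0"
    using qpoch_inf_nonzero'[OF q(2) conv[OF xy(1)]] by (auto simp: qpoch_infs_def prod_list_zero_iff mult.assoc)
  ultimately have N: "?N \<noteq> 0"
    using qpoch_inf_nonzero[OF q(2) denominators(1)] qpoch_inf_nonzero[OF q(2) denominators(2)]
      qpoch_inf_nonzero'[OF q(2) convergence] by simp
  have "s sums (A / ?N)"
    using sums_divide[OF sums, of ?N] N by simp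
  moreover have "al_salam_carlitz q [\<alpha>] [x, y] n
              * al_salam_carlitz q (\<beta> # C) ([lam2, lam3] @ D) n * t ^ n / qpoch q q n
      = qpoch q q n * fps_nth (asc_fps q \<alpha> y * asc_fps q 0 x) n * fps_nth (?H * ?G) n * t ^ n" for n
  proof -
    \<comment> \<open>The numerator list is padded to alpha, 0 and paired with y, x, so that y
      shares a factor with alpha. The second family below likewise gets a 0 opposite lam3.\<close>
    have "al_salam_carlitz q [\<alpha>] [x, y] n = qpoch q q n * fps_nth (asc_fps q \<alpha> y * asc_fps q 0 x) n"
      using has_fps_expansion_asc_fps_list[OF q(2), of "[\<alpha>, 0]" "[y, x]"]
      by (intro al_salam_carlitz_eq q) (simp add: mult.commute)
    moreover have "al_salam_carlitz q (\<beta> # C) ([lam2, lam3] @ D) n = qpoch q q n * fps_nth (?H * ?G) n"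
      using has_fps_expansion_asc_fps_list[OF q(2), of "\<beta> # 0 # C" "lam2 # lam3 # D"] len
      by (intro al_salam_carlitz_eq q) (simp add: mult_ac)
    ultimately show ?thesis
      using qpoch_q_q_nonzero[OF q(2), of n] by simp
  qed
  ultimately show ?thesis
    using A(1) N unfolding s_def by (intro exI[of _ "A / ?N"] conjI) simp_all
qed

end
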